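(* Consider an $N$-player game ($N\ge2$) with cost functions $f_i:\mathbb{R}^N\to\mathbb{R}$, $i\in\mathbb{N}=\{1,\dots,N\}$, and player dynamics $\dot x_i=v_i$, $\dot v_i=u_i$ with $x_i,v_i,u_i\in\mathbb{R}$, where the players communicate over an undirected and connected graph $\mathcal{G}$ with node set $\mathbb{N}$, adjacency matrix $[a_{ij}]$ and Laplacian $\mathcal{L}$. Suppose that: (1) each $f_i$ is twice continuously differentiable; (2) there is a constant $m>0$ with $(\mathbf{x}-\mathbf{y})^T(\mathcal{P}(\mathbf{x})-\mathcal{P}(\mathbf{y}))\ge m\|\mathbf{x}-\mathbf{y}\|^2$ for all $\mathbf{x},\mathbf{y}\in\mathbb{R}^N$; (3) there is a constant $h>0$ with $\sup_{\mathbf{x}\in\mathbb{R}^N}\|H(\mathbf{x})\|=h$. Let each player $i\in\mathbb{N}$ use the distributed observer-based control $$u_i=-k_1\frac{\partial f_i}{\partial x_i}(\mathbf{z}_i)-k_1\bar v_i,$$ $$\dot{\bar x}_i=-k_2(\bar x_i-x_i)+\bar v_i,\qquad \dot{\bar v}_i=-k_3(\bar x_i-x_i)+u_i,$$ $$\dot z_{ij}=-k_4\left(\sum_{k=1}^Na_{ik}(z_{ij}-z_{kj})+a_{ij}(z_{ij}-x_j)\right),\quad j\in\mathbb{N},$$ where $\mathbf{z}_i=[z_{i1},\dots,z_{iN}]^T$ and $k_1,k_2,k_3,k_4$ are positive constants. Write $\lambda=\lambda_{min}(\mathcal{L}\otimes I_{N\times N}+A_0)$ and suppose $$k_1>\frac{2\epsilon_3}{2\epsilon_3-1}\left(h+\frac{h\sqrt{N}\max_{i\in\mathbb{N}}\{l_i\}+1}{2\epsilon_1}+\frac{\sqrt{N}+\max_{i\in\mathbb{N}}\{l_i\}}{2}\right),$$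 $$k_4>\frac{\sqrt{N}}{2\lambda}+\frac{N\max_{i\in\mathbb{N}}\{l_i\}}{2\epsilon_2\lambda}+\frac{k_1^2\max_{i\in\mathbb{N}}\{l_i\}}{2\lambda},$$ where $\epsilon_1,\epsilon_2,\epsilon_3$ are positive constants satisfying $\frac{(h\sqrt{N}\max_{i\in\mathbb{N}}\{l_i\}+1)\epsilon_1}{2}+\frac{N\max_{i\in\mathbb{N}}\{l_i\}\epsilon_2}{2}<m$ and $\epsilon_3>\frac12$. Then distributed Nash equilibrium seeking is achieved, i.e., under this strategy, in which each player uses only its own information and that of its neighbors, for every initial condition of the closed-loop system, $$\lim_{t\to\infty}\|\mathbf{x}(t)-\mathbf{x}^*\|=0,\qquad \lim_{t\to\infty}\|\mathbf{v}(t)\|=0,$$ where $\mathbf{x}^*$ is the Nash equilibrium of the game.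
   Context: Notation: $\mathbf{x}=[x_1,\dots,x_N]^T$, $\mathbf{v}=[v_1,\dots,v_N]^T$, $\mathbf{x}_{-i}$ is $\mathbf{x}$ with the entry $x_i$ removed, and $f_i(\mathbf{x})=f_i(x_i,\mathbf{x}_{-i})$. $\|\cdot\|$ is the Euclidean norm for vectors and the induced norm for matrices. $\mathcal{P}(\mathbf{x})=\left[\frac{\partial f_1(\mathbf{x})}{\partial x_1},\dots,\frac{\partial f_N(\mathbf{x})}{\partial x_N}\right]^T$, and $H(\mathbf{x})$ is the $N\times N$ matrix whose $(i,j)$ entry is $\frac{\partial^2 f_i(\mathbf{x})}{\partial x_i\partial x_j}$. $\frac{\partial f_i}{\partial x_i}(\mathbf{z}_i)=\frac{\partial f_i(\mathbf{x})}{\partial x_i}\big|_{\mathbf{x}=\mathbf{z}_i}$. A Nash equilibrium is a profile $\mathbf{x}^*=(x_i^*,\mathbf{x}_{-i}^* )$ with $f_i(x_i^*,\mathbf{x}_{-i}^* )\le f_i(x_i,\mathbf{x}_{-i}^* )$ for all $x_i\in\mathbb{R}$, $i\in\mathbb{N}$. Under hypotheses (1)-(2) the Nash equilibrium is unique, and $\mathcal{P}(\mathbf{x}^* )=\mathbf{0}$. By (3), each $\frac{\partial f_i}{\partial x_i}$ is globally Lipschitz on $\mathbb{R}^N$; $l_i$ denotes its Lipschitz constant: $\left|\frac{\partial f_i}{\partial x_i}(\mathbf{x})-\frac{\partial f_i}{\partial x_i}(\mathbf{y})\right|\le l_i\|\mathbf{x}-\mathbf{y}\|$ for all $\mathbf{x},\mathbf{y}\in\mathbb{R}^N$.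 Graph: $\mathcal{G}=(\mathbb{N},\mathcal{E})$ is undirected; $a_{ij}=1$ if $(j,i)\in\mathcal{E}$, $a_{ij}=0$ otherwise, and $a_{ii}=0$. $\mathcal{L}=\mathcal{D}-\mathcal{A}$ with $\mathcal{A}=[a_{ij}]$ and $\mathcal{D}$ diagonal with $i$th diagonal entry $\sum_{j=1}^Na_{ij}$. $A_0$ is the $N^2\times N^2$ diagonal matrix with diagonal entries $a_{11},a_{12},\dots,a_{1N},a_{21},\dots,a_{NN}$, successively. $I_{N\times N}$ is the identity matrix, $\otimes$ the Kronecker product, and $\lambda_{min}(\Gamma)$ the minimum eigenvalue of a symmetric real matrix $\Gamma$. Since $\mathcal{G}$ is undirected and connected, $\lambda_{min}(\mathcal{L}\otimes I_{N\times N}+A_0)>0$. In the strategy, $\bar v_i$ is player $i$'s estimate of $v_i$, $\bar x_i$ is an auxiliary variable, and $\mathbf{z}_i\in\mathbb{R}^N$ is player $i$'s estimate of $\mathbf{x}$. *)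

theory Defs
  imports "HOL-Analysis.Analysis"
begin

(* The players are the elements of the finite index type 'n, so N = CARD('n). *)

section \<open>Games and partial derivatives\<close>

definition update_at :: "real^'n \<Rightarrow> 'n::finite \<Rightarrow> real \<Rightarrow> real^'n" where
  "update_at x i s = (\<chi> k. if k = i then s else x $ k)"

definition nash_equilibrium :: "('n::finite \<Rightarrow> real^'n \<Rightarrow> real) \<Rightarrow> real^'n \<Rightarrow> bool" where
  "nash_equilibrium f x \<longleftrightarrow> (\<forall>i s. f i x \<le> f i (update_at x i s))"

definition partial_deriv :: "'n::finite \<Rightarrow> (real^'n \<Rightarrow> real) \<Rightarrow> real^'n \<Rightarrow> real" where
  "partial_deriv j g x = deriv (\<lambda>s. g (update_at x j s)) (x $ j)"

(* Differentiability is required explicitly because deriv takes an arbitrary value where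
   the derivative does not exist. *)
definition continuously_differentiable :: "(real^'n::finite \<Rightarrow> real) \<Rightarrow> bool" where
  "continuously_differentiable g \<longleftrightarrow>
     (\<forall>x. g differentiable (at x)) \<and> (\<forall>j. continuous_on UNIV (partial_deriv j g))"

definition twice_continuously_differentiable :: "(real^'n::finite \<Rightarrow> real) \<Rightarrow> bool" where
  "twice_continuously_differentiable g \<longleftrightarrow>
     continuously_differentiable g \<and> (\<forall>j. continuously_differentiable (partial_deriv j g))"

definition pseudo_gradient :: "('n::finite \<Rightarrow> real^'n \<Rightarrow> real) \<Rightarrow> real^'n \<Rightarrow> real^'n" where
  "pseudo_gradient f x = (\<chi> i. partial_deriv i (f i) x)"

definition game_hessian :: "('n::finite \<Rightarrow> real^'n \<Rightarrow> real) \<Rightarrow> real^'n \<Rightarrow> real^'n^'n" where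
  "game_hessian f x = (\<chi> i j. partial_deriv i (partial_deriv j (f i)) x)"

section \<open>The communication graph\<close>

definition undirected_connected :: "('n \<times> 'n) set \<Rightarrow> bool" where
  "undirected_connected E \<longleftrightarrow> sym E \<and> (\<forall>i j. (i, j) \<in> E\<^sup>*)"

(* A possible self-loop in E is ignored, so that the diagonal is always 0. *)
definition adjacency :: "('n::finite \<times> 'n) set \<Rightarrow> real^'n^'n" where
  "adjacency E = (\<chi> i j. if (j, i) \<in> E \<and> i \<noteq> j then 1 else 0)"

definition laplacian :: "('n::finite \<times> 'n) set \<Rightarrow> real^'n^'n" where
  "laplacian E =
     (\<chi> i j. if i = j then \<Sum>k\<in>UNIV. adjacency E $ i $ k else 0) - adjacency E"

(* Rows and columns of the N^2 x N^2 matrices are indexed by pairs (i, j), which stand for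
   the position (i - 1) N + j. *)
definition kronecker :: "real^'n^'n \<Rightarrow> real^'m^'m \<Rightarrow> real^('n::finite \<times> 'm::finite)^('n \<times> 'm)"
  where "kronecker A B = (\<chi> p q. A $ fst p $ fst q * B $ snd p $ snd q)"

definition adjacency_diag :: "('n::finite \<times> 'n) set \<Rightarrow> real^('n \<times> 'n)^('n \<times> 'n)" where
  "adjacency_diag E = (\<chi> p q. if p = q then adjacency E $ fst p $ snd p else 0)"

definition eigenvalues :: "real^'k^'k \<Rightarrow> real set" where
  "eigenvalues M = {c. \<exists>w. w \<noteq> 0 \<and> M *v w = c *\<^sub>R w}"

definition lambda_min :: "real^'k^'k \<Rightarrow> real" where
  "lambda_min M = Min (eigenvalues M)"

section \<open>The closed-loop system\<close>

definition control ::
  "('n::finite \<Rightarrow> real^'n \<Rightarrow> real) \<Rightarrow> real \<Rightarrow> real^'n \<Rightarrow> real^'n^'n \<Rightarrow> real^'n" where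
  "control f k1 vb z = (\<chi> i. - k1 * partial_deriv i (f i) (z $ i) - k1 * vb $ i)"

(* xb and vb are the observer states, z t $ i is player i's estimate of all the actions.
   The initial values at t = 0 are unconstrained. *)
definition closed_loop ::
  "('n::finite \<Rightarrow> real^'n \<Rightarrow> real) \<Rightarrow> ('n \<times> 'n) set \<Rightarrow> real \<Rightarrow> real \<Rightarrow> real \<Rightarrow> real \<Rightarrow>
   (real \<Rightarrow> real^'n) \<Rightarrow> (real \<Rightarrow> real^'n) \<Rightarrow> (real \<Rightarrow> real^'n) \<Rightarrow> (real \<Rightarrow> real^'n) \<Rightarrow>
   (real \<Rightarrow> real^'n^'n) \<Rightarrow> bool" where
  "closed_loop f E k1 k2 k3 k4 x v xb vb z \<longleftrightarrow>
     (\<forall>t\<ge>0. \<forall>i.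
        ((\<lambda>s. x s $ i) has_real_derivative v t $ i) (at t within {0..}) \<and>
        ((\<lambda>s. v s $ i) has_real_derivative control f k1 (vb t) (z t) $ i) (at t within {0..}) \<and>
        ((\<lambda>s. xb s $ i) has_real_derivative
           - k2 * (xb t $ i - x t $ i) + vb t $ i) (at t within {0..}) \<and>
        ((\<lambda>s. vb s $ i) has_real_derivative
           - k3 * (xb t $ i - x t $ i) + control f k1 (vb t) (z t) $ i) (at t within {0..}) \<and>
        (\<forall>j. ((\<lambda>s. z s $ i $ j) has_real_derivative
           - k4 * ((\<Sum>k\<in>UNIV. adjacency E $ i $ k * (z t $ i $ j - z t $ k $ j))
                   + adjacency E $ i $ j * (z t $ i $ j - x t $ j))) (at t within {0..})))"

end

theory Submission
  imports Defs
begin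

text \<open>
  Write \<open>P\<close> for the pseudo-gradient. The game part is a statement about \<open>P\<close> alone: strong monotonicity
  makes each cost convex in the player's own action, so that the Nash equilibria are the zeros of \<open>P\<close>
  (\<open>nash_equilibrium_iff_pseudo_gradient_zero\<close>), and a strongly monotone Lipschitz map has exactly one zero
  (\<open>strongly_monotone_lipschitz_unique_zero\<close>).

  Convergence is proved with a quadratic Lyapunov function in the errors
  \<open>y = x - xs\<close>, \<open>q = v + P x\<close>, \<open>w\<^sub>i\<^sub>j = z\<^sub>i\<^sub>j - x\<^sub>j\<close>, \<open>a = xb - x\<close> and \<open>b = vb - v\<close>. The point of \<open>q\<close> is that
  \<open>x' = q - P x\<close>, so that the positions follow gradient play up to \<open>q\<close>, while the control damps \<open>q\<close> with
  rate \<open>k1\<close> up to the errors \<open>w\<close> and \<open>b\<close>. The array \<open>w\<close> is damped by \<open>k4\<close> times the estimation matrix, the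
  Kronecker product of the Laplacian and the identity plus the diagonal matrix of the adjacencies, and it is
  driven by the velocities. The estimation matrix is positive definite because the graph is connected, and its
  smallest eigenvalue bounds its quadratic form from below (\<open>lambda_min_estimation_matrix\<close>).
  The observer errors satisfy the autonomous stable linear system \<open>a' = - k2 a + b\<close>, \<open>b' = - k3 a\<close>.

  The gain conditions are what Young's inequality demands in order that \<open>V = |y|\<^sup>2 + |q|\<^sup>2 + |w|\<^sup>2\<close> satisfies
  \<open>V' \<le> - 2 \<alpha> V + k1 \<epsilon>3 |b|\<^sup>2\<close> with some \<open>\<alpha> > 0\<close> (\<open>error_dissipation\<close>, \<open>error_dissipation_scalar\<close>). Adding a large
  multiple of the energy of the observer errors (\<open>observer_energy_decay\<close>) absorbs the last term, the sum
  decays exponentially, and with it \<open>y\<close> and \<open>v = q - P x\<close> (\<open>closed_loop_converges\<close>).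

  The bound \<open>h\<close> refers to the matrix of the derivatives \<open>\<partial>\<^sub>i \<partial>\<^sub>j f\<^sub>i\<close>, whereas the derivative of \<open>q\<close> involves the
  Jacobian of \<open>P\<close> with the entries \<open>\<partial>\<^sub>j \<partial>\<^sub>i f\<^sub>i\<close>. They agree by Clairaut's theorem (\<open>partial_deriv_commute\<close>).
\<close>

section \<open>Partial derivatives\<close>

lemma update_at_eq_add_axis: "update_at x j s = x + (s - x $ j) *\<^sub>R axis j 1"
  by (auto simp: update_at_def vec_eq_iff axis_def)

lemma update_at_simps [simp]:
  "update_at x j (x $ j) = x" "update_at x j s $ j = s"
  "update_at (update_at x j s) j t = update_at x j t"
  "k \<noteq> j \<Longrightarrow> update_at x j s $ k = x $ k"
  by (auto simp: update_at_def vec_eq_iff)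

lemma has_derivative_partial_derivs:
  fixes g :: "real^'n::finite \<Rightarrow> real"
  assumes "g differentiable (at x)"
  shows "(g has_derivative (\<lambda>w. \<Sum>j\<in>UNIV. partial_deriv j g x * w $ j)) (at x)"
proof -
  obtain g' where g': "(g has_derivative g') (at x)"
    using assms by (auto simp: differentiable_def)
  interpret g': bounded_linear g'
    using g' by (rule has_derivative_bounded_linear)
  have pd: "partial_deriv j g x = g' (axis j 1)" for j
  proof -
    have "((\<lambda>s. update_at x j s) has_derivative (\<lambda>s. s *\<^sub>R axis j 1)) (at (x $ j))"
      unfolding update_at_eq_add_axis by (auto intro!: derivative_eq_intros)
    then have "((\<lambda>s. g (update_at x j s)) has_derivative (\<lambda>s. g' (s *\<^sub>R axis j 1))) (at (x $ j))"
      by (rule has_derivative_compose) (simp add: g')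
    then have "((\<lambda>s. g (update_at x j s)) has_real_derivative g' (axis j 1)) (at (x $ j))"
      by (simp add: has_field_derivative_def g'.scaleR mult.commute[of _ "g' (axis j 1)"])
    then show ?thesis
      unfolding partial_deriv_def by (rule DERIV_imp_deriv)
  qed
  have "g' w = (\<Sum>j\<in>UNIV. partial_deriv j g x * w $ j)" for w
  proof -
    have "g' w = g' (\<Sum>j\<in>UNIV. w $ j *s axis j 1)"
      by (simp add: basis_expansion)
    also have "\<dots> = (\<Sum>j\<in>UNIV. partial_deriv j g x * w $ j)"
      by (simp add: g'.sum scalar_mult_eq_scaleR g'.scaleR pd mult.commute)
    finally show ?thesis .
  qed
  then have "g' = (\<lambda>w. \<Sum>j\<in>UNIV. partial_deriv j g x * w $ j)"
    by (rule ext)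
  then show ?thesis
    using g' by simp
qed

lemma DERIV_update_at:
  fixes g :: "real^'n::finite \<Rightarrow> real"
  assumes "\<And>x. g differentiable (at x)"
  shows "((\<lambda>s. g (update_at x j s)) has_real_derivative partial_deriv j g (update_at x j s)) (at s)"
proof -
  have "((\<lambda>s. update_at x j s) has_derivative (\<lambda>s. s *\<^sub>R axis j 1)) (at s)"
    unfolding update_at_eq_add_axis by (auto intro!: derivative_eq_intros)
  then have "((\<lambda>s. g (update_at x j s)) has_derivative
      (\<lambda>r. \<Sum>k\<in>UNIV. partial_deriv k g (update_at x j s) * (r *\<^sub>R axis j 1) $ k)) (at s)"
    by (rule has_derivative_compose) (intro has_derivative_partial_derivs assms)
  moreover have "(\<Sum>k\<in>UNIV. partial_deriv k g (update_at x j s) * (r *\<^sub>R axis j 1) $ k)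
      = partial_deriv j g (update_at x j s) * r" for r
    by (subst sum.remove[of _ j]) (auto simp: axis_def intro!: sum.neutral)
  ultimately show ?thesis
    by (simp add: has_field_derivative_def)
qed

text \<open>
  The second difference over the square with sides \<open>d e\<^sub>i\<close> and \<open>d e\<^sub>j\<close> is evaluated by two
  applications of the mean value theorem, first in direction \<open>i\<close> and then in direction \<open>j\<close>.
  Since the left-hand side is symmetric in \<open>i\<close> and \<open>j\<close>, this compares the two mixed partials at
  two points that are both close to \<open>x\<close>.
\<close>

lemma rectangle_second_difference_eq:
  fixes g :: "real^'n::finite \<Rightarrow> real"
  assumes g: "\<And>x. g differentiable (at x)"
    and g': "\<And>x. partial_deriv i g differentiable (at x)"
    and ij: "i \<noteq> j" and d: "d > 0"
  shows "\<exists>p. norm (p - x) \<le> 2 * d \<and>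
    g (x + d *\<^sub>R axis i 1 + d *\<^sub>R axis j 1) - g (x + d *\<^sub>R axis i 1) - g (x + d *\<^sub>R axis j 1) + g x
      = d * d * partial_deriv j (partial_deriv i g) p"
proof -
  define u where "u s t = update_at (update_at x i s) j t" for s t
  have swap: "u s t = update_at (update_at x j t) i s" for s t
    using ij by (auto simp: u_def update_at_def vec_eq_iff)
  have u_eq: "u s t = x + (s - x $ i) *\<^sub>R axis i 1 + (t - x $ j) *\<^sub>R axis j 1" for s t
    using ij by (auto simp: u_def update_at_def vec_eq_iff axis_def)
  define \<phi> where "\<phi> s = g (u s (x $ j + d)) - g (u s (x $ j))" for s
  have "(\<phi> has_real_derivative
      partial_deriv i g (u s (x $ j + d)) - partial_deriv i g (u s (x $ j))) (at s)" for s
    unfolding \<phi>_def swap by (intro DERIV_diff DERIV_update_at g)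
  then obtain \<xi> where \<xi>: "x $ i < \<xi>" "\<xi> < x $ i + d"
    and 1: "\<phi> (x $ i + d) - \<phi> (x $ i)
      = d * (partial_deriv i g (u \<xi> (x $ j + d)) - partial_deriv i g (u \<xi> (x $ j)))"
    using MVT2[of "x $ i" "x $ i + d" \<phi>
        "\<lambda>s. partial_deriv i g (u s (x $ j + d)) - partial_deriv i g (u s (x $ j))"] d by auto
  have "((\<lambda>t. partial_deriv i g (u \<xi> t)) has_real_derivative
      partial_deriv j (partial_deriv i g) (u \<xi> t)) (at t)" for t
    unfolding u_def by (intro DERIV_update_at g')
  then obtain \<eta> where \<eta>: "x $ j < \<eta>" "\<eta> < x $ j + d"
    and 2: "partial_deriv i g (u \<xi> (x $ j + d)) - partial_deriv i g (u \<xi> (x $ j))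
      = d * partial_deriv j (partial_deriv i g) (u \<xi> \<eta>)"
    using MVT2[of "x $ j" "x $ j + d" "\<lambda>t. partial_deriv i g (u \<xi> t)"
        "\<lambda>t. partial_deriv j (partial_deriv i g) (u \<xi> t)"] d by auto
  have "norm (u \<xi> \<eta> - x) = norm ((\<xi> - x $ i) *\<^sub>R axis i (1::real) + (\<eta> - x $ j) *\<^sub>R axis j 1)"
    by (simp add: u_eq add.assoc)
  also have "\<dots> \<le> norm ((\<xi> - x $ i) *\<^sub>R axis i (1::real) :: real^'n) + norm ((\<eta> - x $ j) *\<^sub>R axis j (1::real) :: real^'n)"
    by (rule norm_triangle_ineq)
  also have "\<dots> \<le> 2 * d"
    using \<xi> \<eta> by simp
  finally have "norm (u \<xi> \<eta> - x) \<le> 2 * d" .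
  moreover have "g (x + d *\<^sub>R axis i 1 + d *\<^sub>R axis j 1) - g (x + d *\<^sub>R axis i 1)
      - g (x + d *\<^sub>R axis j 1) + g x = \<phi> (x $ i + d) - \<phi> (x $ i)"
    by (simp add: \<phi>_def u_eq)
  ultimately show ?thesis
    using 1 2 by (intro exI[of _ "u \<xi> \<eta>"]) simp
qed

text \<open>
  Clairaut's theorem: letting the square shrink to \<open>x\<close>, continuity carries the equality of the
  mixed partials at nearby points over to \<open>x\<close>. It is what makes \<^const>\<open>game_hessian\<close> the Jacobian of
  the pseudo-gradient: the entries of the former are \<open>\<partial>\<^sub>i \<partial>\<^sub>j f\<^sub>i\<close>, those of the latter \<open>\<partial>\<^sub>j \<partial>\<^sub>i f\<^sub>i\<close>.
\<close>

lemma partial_deriv_commute: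
  fixes g :: "real^'n::finite \<Rightarrow> real"
  assumes "twice_continuously_differentiable g"
  shows "partial_deriv i (partial_deriv j g) x = partial_deriv j (partial_deriv i g) x"
proof (cases "i = j")
  case False
  define A where "A = partial_deriv j (partial_deriv i g)"
  define B where "B = partial_deriv i (partial_deriv j g)"
  have g: "\<And>y. g differentiable (at y)"
    and g': "\<And>k y. partial_deriv k g differentiable (at y)"
    and cont: "isCont A x" "isCont B x"
    using assms unfolding twice_continuously_differentiable_def continuously_differentiable_def
      A_def B_def by (auto simp: continuous_on_eq_continuous_at)
  have "\<exists>p q. norm (p - x) \<le> 2 * d \<and> norm (q - x) \<le> 2 * d \<and> A p = B q" if d: "d > 0" for d
  proof -
    obtain p where p: "norm (p - x) \<le> 2 * d"
      "g (x + d *\<^sub>R axis i 1 + d *\<^sub>R axis j 1) - g (x + d *\<^sub>R axis i 1) - g (x + d *\<^sub>R axis j 1) + g x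
        = d * d * A p"
      using rectangle_second_difference_eq[OF g g' False d, of x] by (auto simp: A_def)
    obtain q where q: "norm (q - x) \<le> 2 * d"
      "g (x + d *\<^sub>R axis j 1 + d *\<^sub>R axis i 1) - g (x + d *\<^sub>R axis j 1) - g (x + d *\<^sub>R axis i 1) + g x
        = d * d * B q"
      using rectangle_second_difference_eq[OF g g' False[symmetric] d, of x] by (auto simp: B_def)
    have "g (x + d *\<^sub>R axis j 1 + d *\<^sub>R axis i 1) = g (x + d *\<^sub>R axis i 1 + d *\<^sub>R axis j 1)"
      by (simp add: add_ac)
    then have "d * d * A p = d * d * B q"
      using p(2) q(2) by linarith
    then show ?thesis
      using p(1) q(1) d by auto
  qed
  then have "\<exists>p q. norm (p - x) \<le> 2 * inverse (real (Suc n)) \<and>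
      norm (q - x) \<le> 2 * inverse (real (Suc n)) \<and> A p = B q" for n
    by simp
  then obtain p q where pq: "\<And>n. norm (p n - x) \<le> 2 * inverse (real (Suc n))"
      "\<And>n. norm (q n - x) \<le> 2 * inverse (real (Suc n))" "\<And>n. A (p n) = B (q n)"
    by metis
  have lim: "(\<lambda>n. 2 * inverse (real (Suc n))) \<longlonglongrightarrow> 0"
    using tendsto_mult[OF tendsto_const LIMSEQ_inverse_real_of_nat, of 2] by simp
  have "r \<longlonglongrightarrow> x" if "\<And>n. norm (r n - x) \<le> 2 * inverse (real (Suc n))" for r
    by (rule Lim_transform_bound[THEN Lim_null[THEN iffD2], OF _ lim])
      (auto intro!: always_eventually order_trans[OF that] simp del: of_nat_Suc)
  then have "p \<longlonglongrightarrow> x" "q \<longlonglongrightarrow> x"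
    using pq by blast+
  then have "(\<lambda>n. A (p n)) \<longlonglongrightarrow> A x" "(\<lambda>n. B (q n)) \<longlonglongrightarrow> B x"
    using cont isCont_tendsto_compose by blast+
  then have "(\<lambda>n. A (p n)) \<longlonglongrightarrow> A x" "(\<lambda>n. A (p n)) \<longlonglongrightarrow> B x"
    by (simp_all add: pq(3))
  then show ?thesis
    using LIMSEQ_unique unfolding A_def B_def by blast
qed simp

section \<open>Vectors of vectors\<close>

lemma norm_vec_le_mult:
  fixes v :: "'a::real_normed_vector^'n" and w :: "'b::real_normed_vector^'n"
  assumes "\<And>i. norm (v $ i) \<le> c * norm (w $ i)" "c \<ge> 0"
  shows "norm v \<le> c * norm w"
proof -
  have "norm v \<le> L2_set (\<lambda>i. c * norm (w $ i)) UNIV"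
    unfolding norm_vec_def by (rule L2_set_mono) (use assms in auto)
  also have "\<dots> = c * norm w"
    unfolding norm_vec_def using assms(2) by (simp add: L2_set_right_distrib)
  finally show ?thesis .
qed

lemma norm_const_vec:
  fixes a :: "'a::real_normed_vector"
  shows "norm (\<chi> i::'n::finite. a) = sqrt (real CARD('n)) * norm a"
  unfolding norm_vec_def L2_set_def by (simp add: real_sqrt_mult)

lemma has_derivative_vecI:
  fixes F :: "'a::real_normed_vector \<Rightarrow> 'b::euclidean_space^'n"
  assumes "\<And>i. ((\<lambda>x. F x $ i) has_derivative (\<lambda>w. F' w $ i)) (at x within S)"
  shows "(F has_derivative F') (at x within S)"
proof (subst has_derivative_componentwise_within, rule ballI)
  fix b :: "'b^'n"
  assume "b \<in> Basis"
  then obtain i u where "b = axis i u"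
    by (auto simp: Basis_vec_def)
  then show "((\<lambda>x. F x \<bullet> b) has_derivative (\<lambda>w. F' w \<bullet> b)) (at x within S)"
    using assms by (auto simp: inner_axis intro: has_derivative_inner_left)
qed

lemma has_vector_derivative_vecI:
  fixes F :: "real \<Rightarrow> 'b::euclidean_space^'n"
  assumes "\<And>i. ((\<lambda>s. F s $ i) has_vector_derivative D $ i) (at t within S)"
  shows "(F has_vector_derivative D) (at t within S)"
  using assms unfolding has_vector_derivative_def by (intro has_derivative_vecI) simp

section \<open>Nash equilibria and the pseudo-gradient\<close>

text \<open>
  The zeros of \<open>P\<close> are the fixed points of the gradient step \<open>x \<mapsto> x - \<tau> P x\<close>, and for a small step
  size this map is a contraction: expanding the square of the distance of two images, the inner
  product gains \<open>2 \<tau> m\<close> and the quadratic term loses at most \<open>\<tau>\<^sup>2 \<kappa>\<^sup>2\<close>, and \<open>\<tau> = m / \<kappa>\<^sup>2\<close> makes the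
  factor minimal.
\<close>

lemma strongly_monotone_lipschitz_unique_zero:
  fixes P :: "'a::euclidean_space \<Rightarrow> 'a"
  assumes "m > 0" "c \<ge> 0"
    and mono: "\<And>x y. (x - y) \<bullet> (P x - P y) \<ge> m * (norm (x - y))\<^sup>2"
    and lip: "\<And>x y. norm (P x - P y) \<le> c * norm (x - y)"
  shows "\<exists>!x. P x = 0"
proof -
  \<comment> \<open>Enlarging the Lipschitz constant makes it positive and at least \<open>m\<close>, so that the root defining \<open>q\<close> is real.\<close>
  define \<kappa> where "\<kappa> = c + m"
  have \<kappa>: "\<kappa> > 0" "m \<le> \<kappa>" "c \<le> \<kappa>"
    using assms by (auto simp: \<kappa>_def)
  define \<tau> where "\<tau> = m / \<kappa>\<^sup>2"
  have \<tau>: "\<tau> > 0"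
    using \<kappa> \<open>m > 0\<close> by (simp add: \<tau>_def)
  define q where "q = sqrt (1 - (m / \<kappa>)\<^sup>2)"
  have le1: "(m / \<kappa>)\<^sup>2 \<le> 1"
    using \<kappa> \<open>m > 0\<close> by (simp add: power_le_one)
  have q: "0 \<le> q" "q < 1"
    using \<kappa> \<open>m > 0\<close> le1 by (auto simp: q_def)
  have "dist (x - \<tau> *\<^sub>R P x) (y - \<tau> *\<^sub>R P y) \<le> q * dist x y" for x y
  proof -
    define d where "d = x - y"
    define e where "e = P x - P y"
    have "norm e \<le> \<kappa> * norm d"
      using lip[of x y] mult_right_mono[OF \<kappa>(3) norm_ge_zero[of d]] by (simp add: d_def e_def)
    then have e: "(norm e)\<^sup>2 \<le> \<kappa>\<^sup>2 * (norm d)\<^sup>2"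
      by (metis norm_ge_zero power_mono power_mult_distrib)
    have "(norm (d - \<tau> *\<^sub>R e))\<^sup>2 = (norm d)\<^sup>2 - 2 * \<tau> * (d \<bullet> e) + \<tau>\<^sup>2 * (norm e)\<^sup>2"
      unfolding power2_norm_eq_inner
      by (simp add: inner_diff inner_commute power2_eq_square algebra_simps)
    also have "\<dots> \<le> (norm d)\<^sup>2 - 2 * \<tau> * (m * (norm d)\<^sup>2) + \<tau>\<^sup>2 * (\<kappa>\<^sup>2 * (norm d)\<^sup>2)"
      using mono[of x y] \<tau> e by (intro add_mono diff_mono mult_left_mono) (auto simp: d_def e_def)
    also have "\<dots> = (1 - (m / \<kappa>)\<^sup>2) * (norm d)\<^sup>2"
      using \<kappa> by (simp add: \<tau>_def field_simps power2_eq_square)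
    also have "\<dots> = (q * norm d)\<^sup>2"
      using le1 by (simp add: q_def power_mult_distrib)
    finally have "norm (d - \<tau> *\<^sub>R e) \<le> q * norm d"
      by (rule power2_le_imp_le) (use q in simp)
    moreover have "(x - \<tau> *\<^sub>R P x) - (y - \<tau> *\<^sub>R P y) = d - \<tau> *\<^sub>R e"
      by (simp add: d_def e_def scaleR_diff_right)
    ultimately show ?thesis
      by (simp only: dist_norm d_def)
  qed
  then have "\<forall>x y. dist (x - \<tau> *\<^sub>R P x) (y - \<tau> *\<^sub>R P y) \<le> q * dist x y"
    by (intro allI)
  then have "\<exists>!x. x - \<tau> *\<^sub>R P x = x"
    by (rule banach_fix_type[OF q])
  then show ?thesis
    using \<tau> by simp
qed

text \<open>
  Restricted to lines parallel to the \<open>i\<close>-th axis, monotonicity of the pseudo-gradient says that the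
  partial derivative of \<open>f i\<close> in its own variable is nondecreasing. Hence \<open>f i\<close> is convex in that
  variable, and its critical points are global minima.
\<close>

lemma nash_equilibrium_iff_pseudo_gradient_zero:
  fixes f :: "'n::finite \<Rightarrow> real^'n \<Rightarrow> real"
  assumes diff: "\<And>i x. f i differentiable (at x)"
    and mono: "\<And>x y. (x - y) \<bullet> (pseudo_gradient f x - pseudo_gradient f y) \<ge> 0"
  shows "nash_equilibrium f x \<longleftrightarrow> pseudo_gradient f x = 0"
proof
  assume nash: "nash_equilibrium f x"
  have "partial_deriv i (f i) x = 0" for i
    using DERIV_local_min[OF DERIV_update_at[of "f i" x i "x $ i", OF diff] zero_less_one] nash
    by (simp add: nash_equilibrium_def)
  then show "pseudo_gradient f x = 0"
    by (simp add: pseudo_gradient_def vec_eq_iff)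
next
  assume zero: "pseudo_gradient f x = 0"
  show "nash_equilibrium f x"
    unfolding nash_equilibrium_def
  proof (intro allI)
    fix i s
    define \<phi> where "\<phi> r = f i (update_at x i r)" for r
    define \<phi>' where "\<phi>' r = partial_deriv i (f i) (update_at x i r)" for r
    have der: "(\<phi> has_real_derivative \<phi>' r) (at r)" for r
      unfolding \<phi>_def \<phi>'_def by (rule DERIV_update_at[OF diff])
    have sgn: "(r - x $ i) * \<phi>' r \<ge> 0" for r
      using mono[of "update_at x i r" x]
      unfolding zero by (simp add: update_at_eq_add_axis inner_axis' pseudo_gradient_def \<phi>'_def)
    have zero_i: "\<phi>' (x $ i) = 0"
      using zero by (simp add: \<phi>'_def pseudo_gradient_def vec_eq_iff)
    have "\<phi> (x $ i) \<le> \<phi> s"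
    proof (cases "x $ i \<le> s")
      case True
      have "0 \<le> \<phi>' r" if "x $ i \<le> r" for r
        using sgn[of r] that zero_i by (cases "r = x $ i") (auto simp: zero_le_mult_iff)
      then show ?thesis
        by (intro DERIV_nonneg_imp_nondecreasing[OF True]) (auto intro!: exI conjI der)
    next
      case False
      have "\<phi>' r \<le> 0" if "r \<le> x $ i" for r
        using sgn[of r] that zero_i by (cases "r = x $ i") (auto simp: zero_le_mult_iff)
      then show ?thesis
        using False by (intro DERIV_nonpos_imp_nonincreasing[of s "x $ i" \<phi>]) (auto intro!: exI conjI der)
    qed
    then show "f i x \<le> f i (update_at x i s)"
      by (simp add: \<phi>_def)
  qed
qed

lemma pseudo_gradient_has_derivative:
  fixes f :: "'n::finite \<Rightarrow> real^'n \<Rightarrow> real"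
  assumes "\<And>i. twice_continuously_differentiable (f i)"
  shows "(pseudo_gradient f has_derivative (\<lambda>w. game_hessian f x *v w)) (at x)"
proof (rule has_derivative_vecI)
  fix i
  have "partial_deriv i (f i) differentiable (at x)"
    using assms
    by (simp add: twice_continuously_differentiable_def continuously_differentiable_def)
  moreover have "game_hessian f x $ i $ j = partial_deriv j (partial_deriv i (f i)) x" for j
    using partial_deriv_commute[OF assms] by (simp add: game_hessian_def)
  ultimately
  show "((\<lambda>x. pseudo_gradient f x $ i) has_derivative (\<lambda>w. (game_hessian f x *v w) $ i)) (at x)"
    using has_derivative_partial_derivs[of "partial_deriv i (f i)" x]
    by (simp add: pseudo_gradient_def matrix_vector_mult_def)
qed

lemma norm_matrix_vector_mult_le_SUP_onorm:
  fixes H :: "'a \<Rightarrow> real^'n^'m"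
  assumes "bdd_above (range (\<lambda>x. onorm (\<lambda>w. H x *v w)))"
  shows "norm (H x *v w) \<le> (SUP x. onorm (\<lambda>w. H x *v w)) * norm w"
proof -
  have "norm (H x *v w) \<le> onorm (\<lambda>w. H x *v w) * norm w"
    by (rule onorm) simp
  also have "\<dots> \<le> (SUP x. onorm (\<lambda>w. H x *v w)) * norm w"
    using assms by (intro mult_right_mono cSUP_upper) auto
  finally show ?thesis .
qed

section \<open>The smallest eigenvalue of a symmetric matrix\<close>

lemma inner_symmetric_matrix:
  fixes M :: "real^'k^'k"
  assumes "transpose M = M"
  shows "u \<bullet> (M *v w) = (M *v u) \<bullet> w"
  using dot_lmul_matrix[of u M w] assms by (metis transpose_matrix_vector)

text \<open>
  Eigenvectors to distinct eigenvalues are orthogonal, hence linearly independent. Finiteness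
  is needed for the minimum in \<^const>\<open>lambda_min\<close> to be meaningful.
\<close>

lemma finite_eigenvalues_symmetric:
  fixes M :: "real^'k^'k"
  assumes "transpose M = M"
  shows "finite (eigenvalues M)"
proof -
  have "\<forall>c\<in>eigenvalues M. \<exists>w. w \<noteq> 0 \<and> M *v w = c *\<^sub>R w"
    unfolding eigenvalues_def by blast
  then obtain e where e: "\<And>c. c \<in> eigenvalues M \<Longrightarrow> e c \<noteq> 0 \<and> M *v e c = c *\<^sub>R e c"
    by (auto dest!: bchoice)
  have orth: "e c \<bullet> e d = 0" if "c \<in> eigenvalues M" "d \<in> eigenvalues M" "c \<noteq> d" for c d
  proof -
    have "d * (e c \<bullet> e d) = c * (e c \<bullet> e d)"
      using inner_symmetric_matrix[OF assms, of "e c" "e d"] e[OF that(1)] e[OF that(2)] by simp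
    then show ?thesis
      using that(3) by simp
  qed
  have "pairwise orthogonal (e ` eigenvalues M)"
    using orth by (force simp: pairwise_def orthogonal_def)
  moreover have "0 \<notin> e ` eigenvalues M"
    using e by fastforce
  ultimately have "finite (e ` eigenvalues M)"
    using pairwise_orthogonal_independent independent_bound by blast
  moreover have "inj_on e (eigenvalues M)"
    by (rule inj_onI) (metis e inner_eq_zero_iff orth)
  ultimately show ?thesis
    by (rule finite_imageD)
qed

text \<open>
  At a minimizer of the Rayleigh quotient the first variation vanishes. Here the variation is taken
  in the direction of the residual \<open>r = M u - \<mu> u\<close>; the form \<open>w \<bullet> M w - \<mu> |w|\<^sup>2\<close>, which is nonnegative and
  vanishes at \<open>u\<close>, changes by \<open>2 t |r|\<^sup>2 + O(t\<^sup>2)\<close> and would be negative for small \<open>t < 0\<close>.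
\<close>

lemma rayleigh_minimizer_is_eigenvector:
  fixes M :: "real^'k^'k"
  assumes sym: "transpose M = M"
    and low: "\<And>w. \<mu> * (norm w)\<^sup>2 \<le> w \<bullet> (M *v w)"
    and u: "u \<bullet> (M *v u) = \<mu> * (norm u)\<^sup>2"
  shows "M *v u = \<mu> *\<^sub>R u"
proof (rule ccontr)
  define r where "r = M *v u - \<mu> *\<^sub>R u"
  assume "M *v u \<noteq> \<mu> *\<^sub>R u"
  then have a: "r \<bullet> r > 0"
    by (simp add: r_def)
  define K where "K = r \<bullet> (M *v r) - \<mu> * (r \<bullet> r)"
  have ge0: "0 \<le> 2 * t * (r \<bullet> r) + t * t * K" for t
  proof -
    have "0 \<le> (u + t *\<^sub>R r) \<bullet> (M *v (u + t *\<^sub>R r)) - \<mu> * (norm (u + t *\<^sub>R r))\<^sup>2"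
      using low by simp
    also have "(u + t *\<^sub>R r) \<bullet> (M *v (u + t *\<^sub>R r))
        = u \<bullet> (M *v u) + t * (r \<bullet> (M *v u) + u \<bullet> (M *v r)) + t * t * (r \<bullet> (M *v r))"
      by (simp add: inner_add_left inner_add_right matrix_vector_right_distrib
          matrix_vector_mult_scaleR distrib_left)
    also have "u \<bullet> (M *v r) = r \<bullet> (M *v u)"
      by (metis inner_symmetric_matrix[OF sym] inner_commute)
    also have "(norm (u + t *\<^sub>R r))\<^sup>2 = (norm u)\<^sup>2 + 2 * t * (r \<bullet> u) + t * t * (r \<bullet> r)"
      unfolding power2_norm_eq_inner
      by (simp add: inner_add_left inner_add_right inner_commute[of u r] distrib_left)
    also have "u \<bullet> (M *v u) + t * (r \<bullet> (M *v u) + r \<bullet> (M *v u)) + t * t * (r \<bullet> (M *v r))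
        - \<mu> * ((norm u)\<^sup>2 + 2 * t * (r \<bullet> u) + t * t * (r \<bullet> r))
      = (u \<bullet> (M *v u) - \<mu> * (norm u)\<^sup>2) + 2 * t * (r \<bullet> (M *v u) - \<mu> * (r \<bullet> u)) + t * t * K"
      unfolding K_def by algebra
    also have "r \<bullet> (M *v u) - \<mu> * (r \<bullet> u) = r \<bullet> r"
      using inner_diff_right[of r "M *v u" "\<mu> *\<^sub>R u"] unfolding r_def[symmetric] by simp
    finally show ?thesis
      using u by simp
  qed
  define b where "b = (r \<bullet> r) / (\<bar>K\<bar> + 1)"
  have b: "b > 0"
    using a by (simp add: b_def)
  have "b * K \<le> b * (\<bar>K\<bar> + 1)"
    using b by (intro mult_left_mono) auto
  also have "\<dots> = r \<bullet> r"
    by (simp add: b_def)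
  finally have "b * K < 2 * (r \<bullet> r)"
    using a by linarith
  then have "b * (b * K) < b * (2 * (r \<bullet> r))"
    using b by (rule mult_strict_left_mono)
  then show False
    using ge0[of "- b"] by (simp add: algebra_simps)
qed

text \<open>
  By compactness of the sphere the Rayleigh quotient has a minimizer, whose value is an eigenvalue;
  no eigenvalue is smaller, because each is the value of the quotient at its eigenvector.
\<close>

lemma lambda_min_symmetric:
  fixes M :: "real^'k^'k"
  assumes sym: "transpose M = M"
  shows "lambda_min M * (norm w)\<^sup>2 \<le> w \<bullet> (M *v w)"
    and "\<exists>u. u \<noteq> 0 \<and> M *v u = lambda_min M *\<^sub>R u"
proof -
  let ?S = "sphere (0 :: real^'k) 1"
  have "axis undefined 1 \<in> ?S"
    by simp
  then have "?S \<noteq> {}"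
    by blast
  moreover have "continuous_on ?S (\<lambda>w. w \<bullet> (M *v w))"
    by (intro continuous_on_inner continuous_on_id linear_continuous_on
        matrix_vector_mul_bounded_linear)
  ultimately obtain u where "u \<in> ?S" and "\<forall>w\<in>?S. u \<bullet> (M *v u) \<le> w \<bullet> (M *v w)"
    using continuous_attains_inf[OF compact_sphere] by blast
  then have u: "norm u = 1"
    and min: "\<And>w. norm w = 1 \<Longrightarrow> u \<bullet> (M *v u) \<le> w \<bullet> (M *v w)"
    by simp_all
  define \<mu> where "\<mu> = u \<bullet> (M *v u)"
  have low: "\<mu> * (norm w)\<^sup>2 \<le> w \<bullet> (M *v w)" for w
  proof (cases "w = 0")
    case False
    have "\<mu> \<le> (w /\<^sub>R norm w) \<bullet> (M *v (w /\<^sub>R norm w))"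
      unfolding \<mu>_def by (rule min) (use False in simp)
    also have "\<dots> = (w \<bullet> (M *v w)) / (norm w)\<^sup>2"
      by (simp add: matrix_vector_mult_scaleR power2_eq_square divide_inverse)
    finally show ?thesis
      using False by (simp add: field_simps)
  qed simp
  have eig: "M *v u = \<mu> *\<^sub>R u"
    by (rule rayleigh_minimizer_is_eigenvector[OF sym low]) (simp add: \<mu>_def u)
  have "u \<noteq> 0"
    using u by auto
  have "\<mu> \<le> c" if c: "c \<in> eigenvalues M" for c
  proof -
    obtain e where e: "e \<noteq> 0" "M *v e = c *\<^sub>R e"
      using c by (auto simp: eigenvalues_def)
    have "\<mu> * (norm e)\<^sup>2 \<le> c * (norm e)\<^sup>2"
      using low[of e] e by (simp add: power2_norm_eq_inner)
    then show ?thesis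
      using e(1) by simp
  qed
  moreover have "\<mu> \<in> eigenvalues M"
    using eig \<open>u \<noteq> 0\<close> by (auto simp: eigenvalues_def)
  ultimately have "lambda_min M = \<mu>"
    unfolding lambda_min_def using finite_eigenvalues_symmetric[OF sym] by (intro Min_eqI) auto
  then show "lambda_min M * (norm w)\<^sup>2 \<le> w \<bullet> (M *v w)"
    and "\<exists>u. u \<noteq> 0 \<and> M *v u = lambda_min M *\<^sub>R u"
    using low eig \<open>u \<noteq> 0\<close> by auto
qed

section \<open>The estimation matrix of a connected graph\<close>

text \<open>
  The estimation matrix, defined below, as an operator on arrays. With \<open>w\<^sub>i\<^sub>j = z\<^sub>i\<^sub>j - x\<^sub>j\<close> it is the bracket in the
  dynamics of the estimates, since \<open>w\<^sub>i\<^sub>j - w\<^sub>k\<^sub>j = z\<^sub>i\<^sub>j - z\<^sub>k\<^sub>j\<close>.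
\<close>

definition consensus :: "('n::finite \<times> 'n) set \<Rightarrow> real^'n^'n \<Rightarrow> real^'n^'n" where
  "consensus E w = (\<chi> i j. (\<Sum>k\<in>UNIV. adjacency E $ i $ k * (w $ i $ j - w $ k $ j))
     + adjacency E $ i $ j * w $ i $ j)"

definition flatten :: "real^'m^'n \<Rightarrow> real^('n::finite \<times> 'm::finite)" where
  "flatten w = (\<chi> p. w $ fst p $ snd p)"

lemma sum_UNIV_prod:
  "(\<Sum>q\<in>UNIV. g q) = (\<Sum>k\<in>UNIV. \<Sum>n\<in>UNIV. g (k :: 'a::finite, n :: 'b::finite))"
  by (simp add: sum.cartesian_product flip: UNIV_Times_UNIV)

lemma inner_flatten: "flatten u \<bullet> flatten w = u \<bullet> w"
  by (simp add: flatten_def inner_vec_def sum_UNIV_prod)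

lemma norm_flatten: "norm (flatten w) = norm w"
  by (simp add: norm_eq_sqrt_inner inner_flatten)

lemma flatten_surj: "\<exists>w. u = flatten w"
  by (rule exI[of _ "\<chi> i j. u $ (i, j)"]) (simp add: flatten_def)

abbreviation (input) estimation_matrix :: "('n::finite \<times> 'n) set \<Rightarrow> real^('n \<times> 'n)^('n \<times> 'n)" where
  "estimation_matrix E \<equiv> kronecker (laplacian E) (mat 1) + adjacency_diag E"

lemma estimation_matrix_flatten: "estimation_matrix E *v flatten w = flatten (consensus E w)"
proof -
  have "(\<Sum>q\<in>UNIV. (kronecker (laplacian E) (mat 1) $ (i, j) $ q + adjacency_diag E $ (i, j) $ q)
      * w $ fst q $ snd q) = consensus E w $ i $ j" for i j
  proof -
    have "(\<Sum>q\<in>UNIV. kronecker (laplacian E) (mat 1) $ (i, j) $ q * w $ fst q $ snd q)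
        = (\<Sum>k\<in>UNIV. \<Sum>n\<in>UNIV. laplacian E $ i $ k * (if n = j then w $ k $ n else 0))"
      unfolding sum_UNIV_prod by (intro sum.cong refl) (auto simp: kronecker_def mat_def)
    also have "\<dots> = (\<Sum>k\<in>UNIV. laplacian E $ i $ k * w $ k $ j)"
      unfolding sum_distrib_left[symmetric] by simp
    also have "\<dots> = (\<Sum>k\<in>UNIV. (if k = i then (\<Sum>k\<in>UNIV. adjacency E $ i $ k) * w $ i $ j else 0)
        - adjacency E $ i $ k * w $ k $ j)"
      by (rule sum.cong) (auto simp: laplacian_def algebra_simps)
    also have "\<dots> = (\<Sum>k\<in>UNIV. adjacency E $ i $ k * (w $ i $ j - w $ k $ j))"
      unfolding right_diff_distrib sum_subtractf sum_distrib_right[symmetric] by simp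
    finally have 1: "(\<Sum>q\<in>UNIV. kronecker (laplacian E) (mat 1) $ (i, j) $ q * w $ fst q $ snd q)
        = (\<Sum>k\<in>UNIV. adjacency E $ i $ k * (w $ i $ j - w $ k $ j))" .
    have "(\<Sum>q\<in>UNIV. adjacency_diag E $ (i, j) $ q * w $ fst q $ snd q)
        = (\<Sum>q\<in>UNIV. if q = (i, j) then adjacency E $ i $ j * w $ i $ j else 0)"
      by (rule sum.cong) (auto simp: adjacency_diag_def)
    also have "\<dots> = adjacency E $ i $ j * w $ i $ j"
      by simp
    finally have 2: "(\<Sum>q\<in>UNIV. adjacency_diag E $ (i, j) $ q * w $ fst q $ snd q) = \<dots>" .
    show ?thesis
      using 1 2 by (simp add: consensus_def distrib_right sum.distrib)
  qed
  then show ?thesis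
    by (auto simp: vec_eq_iff matrix_vector_mult_def flatten_def)
qed

lemma transpose_estimation_matrix:
  assumes "sym E"
  shows "transpose (estimation_matrix E) = estimation_matrix E"
proof -
  have "adjacency E $ i $ j = adjacency E $ j $ i" for i j
    using assms by (auto simp: adjacency_def dest: symD)
  then have lap: "laplacian E $ i $ j = laplacian E $ j $ i" for i j
    unfolding laplacian_def by (cases "i = j") auto
  show ?thesis
    by (auto simp: vec_eq_iff transpose_def kronecker_def mat_def adjacency_diag_def intro: lap)
qed

text \<open>
  The usual Dirichlet form of the Laplacian: exchanging the summation indices \<open>i\<close> and \<open>k\<close> and adding
  turns \<open>w\<^sub>i\<^sub>j (w\<^sub>i\<^sub>j - w\<^sub>k\<^sub>j)\<close> into a square.
\<close>

lemma inner_consensus: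
  assumes "sym E"
  shows "2 * (w \<bullet> consensus E w) =
    (\<Sum>i\<in>UNIV. \<Sum>j\<in>UNIV. \<Sum>k\<in>UNIV. adjacency E $ i $ k * (w $ i $ j - w $ k $ j)\<^sup>2)
    + 2 * (\<Sum>i\<in>UNIV. \<Sum>j\<in>UNIV. adjacency E $ i $ j * (w $ i $ j)\<^sup>2)"
proof -
  have adj: "adjacency E $ i $ j = adjacency E $ j $ i" for i j
    using assms by (auto simp: adjacency_def dest: symD)
  let ?T = "\<Sum>i\<in>UNIV. \<Sum>j\<in>UNIV. \<Sum>k\<in>UNIV. adjacency E $ i $ k * (w $ i $ j * (w $ i $ j - w $ k $ j))"
  have "?T = (\<Sum>j\<in>UNIV. \<Sum>i\<in>UNIV. \<Sum>k\<in>UNIV. adjacency E $ i $ k * (w $ i $ j * (w $ i $ j - w $ k $ j)))"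
    by (rule sum.swap)
  also have "\<dots> = (\<Sum>j\<in>UNIV. \<Sum>k\<in>UNIV. \<Sum>i\<in>UNIV. adjacency E $ i $ k * (w $ i $ j * (w $ i $ j - w $ k $ j)))"
    by (rule sum.cong[OF refl], rule sum.swap)
  also have "\<dots> = (\<Sum>k\<in>UNIV. \<Sum>j\<in>UNIV. \<Sum>i\<in>UNIV. adjacency E $ i $ k * (w $ i $ j * (w $ i $ j - w $ k $ j)))"
    by (rule sum.swap)
  also have "\<dots> = (\<Sum>i\<in>UNIV. \<Sum>j\<in>UNIV. \<Sum>k\<in>UNIV. adjacency E $ i $ k * (w $ k $ j * (w $ k $ j - w $ i $ j)))"
    by (simp add: adj)
  finally have "2 * ?T = ?T + (\<Sum>i\<in>UNIV. \<Sum>j\<in>UNIV. \<Sum>k\<in>UNIV. adjacency E $ i $ k * (w $ k $ j * (w $ k $ j - w $ i $ j)))"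
    by simp
  also have "\<dots> = (\<Sum>i\<in>UNIV. \<Sum>j\<in>UNIV. \<Sum>k\<in>UNIV. adjacency E $ i $ k * (w $ i $ j - w $ k $ j)\<^sup>2)"
    unfolding sum.distrib[symmetric]
    by (intro sum.cong refl) (simp add: power2_eq_square algebra_simps)
  finally have "2 * ?T = (\<Sum>i\<in>UNIV. \<Sum>j\<in>UNIV. \<Sum>k\<in>UNIV. adjacency E $ i $ k * (w $ i $ j - w $ k $ j)\<^sup>2)" .
  moreover have "w \<bullet> consensus E w = ?T + (\<Sum>i\<in>UNIV. \<Sum>j\<in>UNIV. adjacency E $ i $ j * (w $ i $ j)\<^sup>2)"
    by (simp add: inner_vec_def consensus_def power2_eq_square distrib_left sum.distrib sum_distrib_left mult_ac)
  ultimately show ?thesis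
    by simp
qed

text \<open>
  \<open>E\<close> may contain self-loops, so the first edge of a path to another node does not suffice: without
  a proper neighbour every path from \<open>j\<close> would stay in \<open>j\<close>.
\<close>

lemma connected_has_neighbour:
  assumes conn: "\<And>i j. (i, j) \<in> E\<^sup>*" and "CARD('n::finite) \<ge> 2"
  shows "\<exists>i. (j, i :: 'n) \<in> E \<and> i \<noteq> j"
proof (rule ccontr)
  assume stuck: "\<nexists>i. (j, i) \<in> E \<and> i \<noteq> j"
  have "i = j" if "(j, i) \<in> E\<^sup>*" for i
    using that by induction (use stuck in auto)
  then have "(UNIV :: 'n set) = {j}"
    using conn by auto
  then have "CARD('n) = 1"
    by (metis card_1_singleton_iff One_nat_def)
  then show False
    using assms(2) by simp
qed

text \<open>
  If the form vanishes, then for each \<open>j\<close> the Dirichlet part makes \<open>w\<^sub>i\<^sub>j\<close> independent of \<open>i\<close> by connectivity,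
  and the part coming from the diagonal matrix makes it zero at a neighbour \<open>i\<close> of \<open>j\<close>.
\<close>

lemma inner_consensus_pos:
  fixes w :: "real^'n::finite^'n"
  assumes "undirected_connected E" "CARD('n) \<ge> 2" "w \<noteq> 0"
  shows "w \<bullet> consensus E w > 0"
proof (rule ccontr)
  have sym: "sym E" and conn: "\<And>i j. (i, j) \<in> E\<^sup>*"
    using assms(1) by (auto simp: undirected_connected_def)
  have nn: "adjacency E $ i $ j \<ge> 0" for i j
    by (simp add: adjacency_def)
  let ?D = "\<Sum>i\<in>UNIV. \<Sum>j\<in>UNIV. \<Sum>k\<in>UNIV. adjacency E $ i $ k * (w $ i $ j - w $ k $ j)\<^sup>2"
  let ?F = "\<Sum>i\<in>UNIV. \<Sum>j\<in>UNIV. adjacency E $ i $ j * (w $ i $ j)\<^sup>2"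
  assume "\<not> w \<bullet> consensus E w > 0"
  moreover have "?D \<ge> 0" "?F \<ge> 0"
    using nn by (auto intro!: sum_nonneg)
  ultimately have "?D = 0" "?F = 0"
    using inner_consensus[OF sym, of w] by linarith+
  then have D: "adjacency E $ i $ k * (w $ i $ j - w $ k $ j)\<^sup>2 = 0"
    and F: "adjacency E $ i $ j * (w $ i $ j)\<^sup>2 = 0" for i j k
    using nn by (simp_all add: sum_nonneg_eq_0_iff sum_nonneg)
  have edge: "w $ i $ j = w $ k $ j" if "(k, i) \<in> E" for i j k
    using D[of i k j] that by (cases "i = k") (auto simp: adjacency_def)
  have const: "w $ i $ j = w $ k $ j" for i j k
    using conn[of k i] by induction (use edge in auto)
  have "w $ i $ j = 0" for i j
  proof -
    obtain k where "(j, k) \<in> E" "k \<noteq> j"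
      using connected_has_neighbour[OF conn assms(2)] by blast
    then have "w $ k $ j = 0"
      using F[of k j] by (simp add: adjacency_def)
    then show ?thesis
      using const by metis
  qed
  then show False
    using assms(3) by (simp add: vec_eq_iff)
qed

lemma lambda_min_estimation_matrix:
  fixes E :: "('n::finite \<times> 'n) set"
  assumes "undirected_connected E" "CARD('n) \<ge> 2"
  shows "lambda_min (estimation_matrix E) > 0"
    and "lambda_min (estimation_matrix E) * (norm w)\<^sup>2 \<le> w \<bullet> consensus E w"
proof -
  have sym: "transpose (estimation_matrix E) = estimation_matrix E"
    using assms(1) by (simp add: transpose_estimation_matrix undirected_connected_def)
  show "lambda_min (estimation_matrix E) * (norm w)\<^sup>2 \<le> w \<bullet> consensus E w"
    using lambda_min_symmetric(1)[OF sym, of "flatten w"]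
    by (simp add: estimation_matrix_flatten inner_flatten norm_flatten)
  obtain u where u: "u \<noteq> 0" "estimation_matrix E *v u = lambda_min (estimation_matrix E) *\<^sub>R u"
    using lambda_min_symmetric(2)[OF sym] by blast
  obtain v where v: "u = flatten v"
    using flatten_surj by blast
  have "v \<noteq> 0"
    using u(1) v norm_flatten[of v] by auto
  then have "0 < v \<bullet> consensus E v"
    by (rule inner_consensus_pos[OF assms])
  also have "\<dots> = u \<bullet> (estimation_matrix E *v u)"
    by (simp add: v estimation_matrix_flatten inner_flatten)
  also have "\<dots> = lambda_min (estimation_matrix E) * (norm u)\<^sup>2"
    by (simp add: u(2) power2_norm_eq_inner)
  finally show "lambda_min (estimation_matrix E) > 0"
    by (simp add: zero_less_mult_iff)
qed

section \<open>Energy estimates\<close>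

text \<open>
  Gronwall's argument: \<open>W t exp (c t)\<close> is nonincreasing.
\<close>

lemma differential_inequality_tendsto_zero:
  fixes W D :: "real \<Rightarrow> real"
  assumes der: "\<And>t. t \<ge> 0 \<Longrightarrow> (W has_real_derivative D t) (at t within {0..})"
    and D: "\<And>t. t \<ge> 0 \<Longrightarrow> D t \<le> - c * W t"
    and nonneg: "\<And>t. t \<ge> 0 \<Longrightarrow> W t \<ge> 0" and c: "c > 0"
  shows "(W \<longlongrightarrow> 0) at_top"
proof -
  have bound: "W t \<le> W 0 * exp (- c * t)" if t: "t \<ge> 0" for t
  proof -
    have cont: "continuous_on {0..t} W"
      unfolding continuous_on_eq_continuous_within
      by (auto intro: continuous_within_subset[OF DERIV_continuous[OF der]])
    have "W t * exp (c * t) \<le> W 0 * exp (c * 0)"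
    proof (rule DERIV_nonpos_imp_decreasing_open[OF t])
      fix s assume s: "0 < s" "s < t"
      have "(W has_real_derivative D s) (at s)"
        using der[of s] s at_within_interior[of s "{0..}"] by simp
      then have "((\<lambda>t. W t * exp (c * t)) has_real_derivative (D s + c * W s) * exp (c * s)) (at s)"
        by (auto intro!: derivative_eq_intros simp: algebra_simps)
      moreover have "(D s + c * W s) * exp (c * s) \<le> 0"
        using D[of s] s by (intro mult_nonpos_nonneg) auto
      ultimately show "\<exists>y. ((\<lambda>t. W t * exp (c * t)) has_real_derivative y) (at s) \<and> y \<le> 0"
        by blast
    qed (intro continuous_intros cont)
    then have "W t * exp (c * t) * exp (- c * t) \<le> W 0 * exp (- c * t)"
      by (intro mult_right_mono) auto
    then show ?thesis
      by (simp add: mult.assoc flip: exp_add)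
  qed
  have "LIM t at_top. - c * t :> at_bot"
    using c by (intro filterlim_tendsto_neg_mult_at_bot[OF tendsto_const _ filterlim_ident]) auto
  then have lim: "((\<lambda>t. W 0 * exp (- c * t)) \<longlongrightarrow> 0) at_top"
    by (intro tendsto_mult_right_zero filterlim_compose[OF exp_at_bot])
  show ?thesis
  proof (rule tendsto_sandwich[OF _ _ tendsto_const lim])
    show "\<forall>\<^sub>F t in at_top. 0 \<le> W t"
      using nonneg by (intro eventually_at_top_linorderI[of 0])
    show "\<forall>\<^sub>F t in at_top. W t \<le> W 0 * exp (- c * t)"
      using bound by (intro eventually_at_top_linorderI[of 0])
  qed
qed

lemma has_real_derivative_inner:
  fixes a b :: "real \<Rightarrow> 'a::real_inner"
  assumes "(a has_vector_derivative a') (at t within S)"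
    and "(b has_vector_derivative b') (at t within S)"
  shows "((\<lambda>s. a s \<bullet> b s) has_real_derivative a t \<bullet> b' + a' \<bullet> b t) (at t within S)"
  unfolding has_real_derivative_iff_has_vector_derivative
  by (rule bounded_bilinear.has_vector_derivative[OF bounded_bilinear_inner assms])

lemma has_real_derivative_norm_square:
  fixes a :: "real \<Rightarrow> 'a::real_inner"
  assumes "(a has_vector_derivative a') (at t within S)"
  shows "((\<lambda>s. (norm (a s))\<^sup>2) has_real_derivative 2 * (a t \<bullet> a')) (at t within S)"
  using has_real_derivative_inner[OF assms assms]
  by (simp add: power2_norm_eq_inner inner_commute)

lemma young_inequality:
  fixes a b :: real
  assumes "\<epsilon> > 0"
  shows "a * b \<le> \<epsilon> / 2 * a\<^sup>2 + b\<^sup>2 / (2 * \<epsilon>)"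
proof -
  have "0 \<le> (\<epsilon> * a - b)\<^sup>2 / (2 * \<epsilon>)"
    using assms by simp
  also have "\<dots> = \<epsilon> / 2 * a\<^sup>2 + b\<^sup>2 / (2 * \<epsilon>) - a * b"
    using assms by (simp add: field_simps power2_eq_square)
  finally show ?thesis
    by simp
qed

text \<open>
  The weight \<open>\<delta>\<close> of the cross term in the observer energy. It solves \<open>\<delta> (2 k3 + k2\<^sup>2) = k2 k3\<close>, so that the
  cross term costs just half of the damping \<open>2 k2 k3 |a|\<^sup>2\<close> in the first observer error.
\<close>

definition cross_weight :: "real \<Rightarrow> real \<Rightarrow> real" where
  "cross_weight k2 k3 = k2 * k3 / (2 * k3 + k2\<^sup>2)"

text \<open>
  A Lyapunov function of the linear system \<open>a' = - k2 a + b\<close>, \<open>b' = - k3 a\<close> of the observer errors.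
  Without the cross term its derivative would be \<open>- 2 k2 k3 |a|\<^sup>2\<close>, which does not control \<open>b\<close>.
\<close>

definition observer_energy :: "real \<Rightarrow> real \<Rightarrow> 'a::real_inner \<Rightarrow> 'a \<Rightarrow> real" where
  "observer_energy k2 k3 a b =
     k3 * (norm a)\<^sup>2 + (norm b)\<^sup>2 - 2 * cross_weight k2 k3 * (a \<bullet> b)"

context
  fixes k2 k3 :: real
  assumes k: "k2 > 0" "k3 > 0"
begin

lemma cross_weight_pos: "cross_weight k2 k3 > 0"
  using k by (simp add: cross_weight_def add_pos_pos)

lemma cross_weight_eq: "cross_weight k2 k3 * (2 * k3 + k2\<^sup>2) = k2 * k3"
  using k by (simp add: cross_weight_def add_pos_pos less_imp_neq[symmetric])

text \<open>
  This is what makes the observer energy nonnegative: the cross term is at most \<open>\<delta>\<^sup>2 |a|\<^sup>2 + |b|\<^sup>2\<close>.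
\<close>

lemma cross_weight_square_le: "(cross_weight k2 k3)\<^sup>2 \<le> k3"
proof -
  let ?d = "cross_weight k2 k3"
  have "?d * (2 * k3) \<le> ?d * (2 * k3 + k2\<^sup>2)"
    using cross_weight_pos by (intro mult_left_mono) auto
  then have "(2 * ?d) * k3 \<le> k2 * k3"
    unfolding cross_weight_eq by (simp add: mult_ac)
  then have "2 * ?d \<le> k2"
    using k by simp
  have "?d * k2\<^sup>2 \<le> ?d * (2 * k3 + k2\<^sup>2)"
    using k cross_weight_pos by (intro mult_left_mono) auto
  then have "(?d * k2) * k2 \<le> k3 * k2"
    unfolding cross_weight_eq by (simp add: mult_ac power2_eq_square)
  then have "?d * k2 \<le> k3"
    using k by simp
  moreover have "?d * ?d \<le> ?d * k2"
    using cross_weight_pos \<open>2 * ?d \<le> k2\<close> by (intro mult_left_mono) auto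
  ultimately show ?thesis
    by (simp add: power2_eq_square)
qed

lemma observer_energy_bounds:
  "0 \<le> observer_energy k2 k3 a b"
  "observer_energy k2 k3 a b \<le> 2 * (k3 + 1) * ((norm a)\<^sup>2 + (norm b)\<^sup>2)"
proof -
  let ?d = "cross_weight k2 k3"
  have "\<bar>2 * ?d * (a \<bullet> b)\<bar> = 2 * ?d * \<bar>a \<bullet> b\<bar>"
    using cross_weight_pos by (simp add: abs_mult)
  also have "\<dots> \<le> 2 * ?d * (norm a * norm b)"
    using cross_weight_pos by (intro mult_left_mono Cauchy_Schwarz_ineq2) auto
  also have "\<dots> \<le> ?d\<^sup>2 * (norm a)\<^sup>2 + (norm b)\<^sup>2"
    using sum_squares_bound[of "?d * norm a" "norm b"] by (simp add: power_mult_distrib mult_ac)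
  also have "\<dots> \<le> k3 * (norm a)\<^sup>2 + (norm b)\<^sup>2"
    using cross_weight_square_le by (intro add_mono mult_right_mono) auto
  finally have *: "\<bar>2 * ?d * (a \<bullet> b)\<bar> \<le> k3 * (norm a)\<^sup>2 + (norm b)\<^sup>2" .
  then show "0 \<le> observer_energy k2 k3 a b"
    unfolding observer_energy_def by linarith
  have "observer_energy k2 k3 a b \<le> 2 * (k3 * (norm a)\<^sup>2 + (norm b)\<^sup>2)"
    using abs_le_D2[OF *] unfolding observer_energy_def by (simp add: algebra_simps)
  also have "\<dots> \<le> 2 * (k3 * (norm a)\<^sup>2 + (norm b)\<^sup>2) + 2 * (norm a)\<^sup>2 + 2 * (k3 * (norm b)\<^sup>2)"
    using k by simp
  also have "\<dots> = 2 * (k3 + 1) * ((norm a)\<^sup>2 + (norm b)\<^sup>2)"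
    by (simp add: algebra_simps)
  finally show "observer_energy k2 k3 a b \<le> \<dots>" .
qed

lemma observer_energy_decay:
  assumes a: "(a has_vector_derivative - k2 *\<^sub>R a t + b t) (at t within S)"
    and b: "(b has_vector_derivative - k3 *\<^sub>R a t) (at t within S)"
  shows "\<exists>D. ((\<lambda>s. observer_energy k2 k3 (a s) (b s)) has_real_derivative D) (at t within S) \<and>
    D \<le> - min (k2 * k3) (cross_weight k2 k3) * ((norm (a t))\<^sup>2 + (norm (b t))\<^sup>2)"
proof (intro exI conjI)
  let ?d = "cross_weight k2 k3"
  let ?A = "(norm (a t))\<^sup>2" and ?B = "(norm (b t))\<^sup>2" and ?p = "a t \<bullet> b t"
  let ?D = "k3 * (2 * (a t \<bullet> (- k2 *\<^sub>R a t + b t))) + 2 * (b t \<bullet> (- k3 *\<^sub>R a t))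
    - 2 * ?d * (a t \<bullet> (- k3 *\<^sub>R a t) + (- k2 *\<^sub>R a t + b t) \<bullet> b t)"
  show "((\<lambda>s. observer_energy k2 k3 (a s) (b s)) has_real_derivative ?D) (at t within S)"
    unfolding observer_energy_def
    by (intro DERIV_diff DERIV_add DERIV_cmult has_real_derivative_norm_square
        has_real_derivative_inner a b)
  have "?D = - (2 * k2 * k3 - 2 * ?d * k3) * ?A + 2 * ?d * (k2 * ?p) - 2 * ?d * ?B"
    by (simp add: inner_add_left inner_add_right power2_norm_eq_inner inner_commute[of "b t" "a t"]
        algebra_simps)
  also have "2 * ?d * (k2 * ?p) \<le> ?d * (k2\<^sup>2 * ?A + ?B)"
  proof -
    have "2 * (k2 * ?p) \<le> 2 * (k2 * (norm (a t) * norm (b t)))"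
      using k norm_cauchy_schwarz[of "a t" "b t"] by simp
    also have "\<dots> \<le> k2\<^sup>2 * ?A + ?B"
      using sum_squares_bound[of "k2 * norm (a t)" "norm (b t)"]
      by (simp add: power_mult_distrib mult_ac)
    finally have "?d * (2 * (k2 * ?p)) \<le> ?d * (k2\<^sup>2 * ?A + ?B)"
      using cross_weight_pos by (intro mult_left_mono) auto
    then show ?thesis
      by (simp add: mult_ac)
  qed
  also have "- (2 * k2 * k3 - 2 * ?d * k3) * ?A + ?d * (k2\<^sup>2 * ?A + ?B) - 2 * ?d * ?B
      = - (2 * k2 * k3 - ?d * (2 * k3 + k2\<^sup>2)) * ?A - ?d * ?B"
    by (simp add: algebra_simps)
  also have "\<dots> = - (k2 * k3 * ?A + ?d * ?B)"
    by (simp add: cross_weight_eq)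
  also have "\<dots> \<le> - (min (k2 * k3) ?d * ?A + min (k2 * k3) ?d * ?B)"
    by (intro le_imp_neg_le add_mono mult_right_mono) auto
  finally show "?D \<le> - min (k2 * k3) ?d * (?A + ?B)"
    by (simp add: distrib_left)
qed

end

text \<open>
  All mixed products are split by Young's inequality with the weights \<open>\<epsilon>1\<close> for \<open>Y Q\<close>, \<open>\<epsilon>2\<close> for \<open>Y Z\<close>,
  \<open>\<epsilon>3\<close> for \<open>Q e\<close> and \<open>1\<close> for both \<open>Q Z\<close> and \<open>Q (k1 Z)\<close>. The coefficients of the squares on the right are then exactly the quantities
  that the gain conditions make positive.
\<close>

lemma error_dissipation_scalar:
  fixes Y Q Z e :: real
  assumes "sN \<ge> 0" "L \<ge> 0" "h \<ge> 0" "k1 > 0"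
    and \<epsilon>: "\<epsilon>1 > 0" "\<epsilon>2 > 0" "\<epsilon>3 > 0"
  shows "Y * Q - m * Y\<^sup>2 + k1 * L * (Q * Z) - k1 * Q\<^sup>2 + k1 * (Q * e) + h * (Q * (Q + sN * L * Y))
      - k4 * lam * Z\<^sup>2 + sN * (Z * (Q + sN * L * Y))
    \<le> - (m - ((h * sN * L + 1) * \<epsilon>1 / 2 + sN\<^sup>2 * L * \<epsilon>2 / 2)) * Y\<^sup>2
      - (k1 - k1 / (2 * \<epsilon>3) - (h + (h * sN * L + 1) / (2 * \<epsilon>1) + (sN + L) / 2)) * Q\<^sup>2
      - (k4 * lam - (sN / 2 + sN\<^sup>2 * L / (2 * \<epsilon>2) + k1\<^sup>2 * L / 2)) * Z\<^sup>2
      + k1 * \<epsilon>3 / 2 * e\<^sup>2"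
proof -
  have 1: "(h * sN * L + 1) * (Y * Q) \<le> (h * sN * L + 1) * (\<epsilon>1 / 2 * Y\<^sup>2 + Q\<^sup>2 / (2 * \<epsilon>1))"
    using assms by (intro mult_left_mono young_inequality) auto
  have 2: "sN\<^sup>2 * L * (Y * Z) \<le> sN\<^sup>2 * L * (\<epsilon>2 / 2 * Y\<^sup>2 + Z\<^sup>2 / (2 * \<epsilon>2))"
    using assms by (intro mult_left_mono young_inequality) auto
  have 3: "sN * (Q * Z) \<le> sN * (1 / 2 * Q\<^sup>2 + Z\<^sup>2 / (2 * 1))"
    using assms by (intro mult_left_mono young_inequality) auto
  have 4: "L * (Q * (k1 * Z)) \<le> L * (1 / 2 * Q\<^sup>2 + (k1 * Z)\<^sup>2 / (2 * 1))"
    using assms by (intro mult_left_mono young_inequality) auto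
  have 5: "k1 * (e * Q) \<le> k1 * (\<epsilon>3 / 2 * e\<^sup>2 + Q\<^sup>2 / (2 * \<epsilon>3))"
    using assms by (intro mult_left_mono young_inequality) auto
  have l: "Y * Q - m * Y\<^sup>2 + k1 * L * (Q * Z) - k1 * Q\<^sup>2 + k1 * (Q * e) + h * (Q * (Q + sN * L * Y))
      - k4 * lam * Z\<^sup>2 + sN * (Z * (Q + sN * L * Y))
    = (h * sN * L + 1) * (Y * Q) + sN\<^sup>2 * L * (Y * Z) + sN * (Q * Z) + L * (Q * (k1 * Z))
      + k1 * (e * Q) - m * Y\<^sup>2 - k1 * Q\<^sup>2 + h * Q\<^sup>2 - k4 * lam * Z\<^sup>2"
    by (simp add: algebra_simps power2_eq_square)
  have r: "- (m - ((h * sN * L + 1) * \<epsilon>1 / 2 + sN\<^sup>2 * L * \<epsilon>2 / 2)) * Y\<^sup>2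
      - (k1 - k1 / (2 * \<epsilon>3) - (h + (h * sN * L + 1) / (2 * \<epsilon>1) + (sN + L) / 2)) * Q\<^sup>2
      - (k4 * lam - (sN / 2 + sN\<^sup>2 * L / (2 * \<epsilon>2) + k1\<^sup>2 * L / 2)) * Z\<^sup>2
      + k1 * \<epsilon>3 / 2 * e\<^sup>2
    = (h * sN * L + 1) * (\<epsilon>1 / 2 * Y\<^sup>2 + Q\<^sup>2 / (2 * \<epsilon>1)) + sN\<^sup>2 * L * (\<epsilon>2 / 2 * Y\<^sup>2 + Z\<^sup>2 / (2 * \<epsilon>2))
      + sN * (1 / 2 * Q\<^sup>2 + Z\<^sup>2 / (2 * 1)) + L * (1 / 2 * Q\<^sup>2 + (k1 * Z)\<^sup>2 / (2 * 1))
      + k1 * (\<epsilon>3 / 2 * e\<^sup>2 + Q\<^sup>2 / (2 * \<epsilon>3)) - m * Y\<^sup>2 - k1 * Q\<^sup>2 + h * Q\<^sup>2 - k4 * lam * Z\<^sup>2"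
    by (simp add: algebra_simps add_divide_distrib diff_divide_distrib power_mult_distrib)
  show ?thesis
    unfolding l r using 1 2 3 4 5 by linarith
qed

section \<open>The closed loop in error coordinates\<close>

text \<open>
  What the players apply in place of the pseudo-gradient: player \<open>i\<close> evaluates the own partial derivative
  at the own estimate \<open>z $ i\<close>, so that \<open>z = (\<chi> i. x)\<close> gives back the pseudo-gradient at \<open>x\<close>.
\<close>

definition own_gradients :: "('n::finite \<Rightarrow> real^'n \<Rightarrow> real) \<Rightarrow> real^'n^'n \<Rightarrow> real^'n" where
  "own_gradients f z = (\<chi> i. partial_deriv i (f i) (z $ i))"

lemma own_gradients_lipschitz:
  assumes lip: "\<And>i. L-lipschitz_on UNIV (partial_deriv i (f i))"
  shows "norm (own_gradients f z - own_gradients f w) \<le> L * norm (z - w)"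
  using lipschitz_on_normD[OF lip] lipschitz_on_nonneg[OF lip]
  by (intro norm_vec_le_mult) (auto simp: own_gradients_def)

lemma pseudo_gradient_eq_own_gradients: "pseudo_gradient f x = own_gradients f (\<chi> i. x)"
  by (simp add: own_gradients_def pseudo_gradient_def)

lemma pseudo_gradient_lipschitz:
  fixes f :: "'n::finite \<Rightarrow> real^'n \<Rightarrow> real"
  assumes lip: "\<And>i. L-lipschitz_on UNIV (partial_deriv i (f i))"
  shows "norm (pseudo_gradient f x - pseudo_gradient f y) \<le> sqrt (real CARD('n)) * L * norm (x - y)"
proof -
  have "norm (pseudo_gradient f x - pseudo_gradient f y) \<le> L * norm ((\<chi> i::'n. x) - (\<chi> i. y))"
    unfolding pseudo_gradient_eq_own_gradients by (rule own_gradients_lipschitz[OF lip])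
  also have "(\<chi> i::'n. x) - (\<chi> i. y) = (\<chi> i. x - y)"
    by (simp add: vec_eq_iff)
  finally show ?thesis
    by (simp add: norm_const_vec mult_ac)
qed

lemma closed_loop_vector_derivatives:
  assumes "closed_loop f E k1 k2 k3 k4 x v xb vb z" "t \<ge> 0"
  defines "u \<equiv> - k1 *\<^sub>R (own_gradients f (z t) + vb t)"
  shows "(x has_vector_derivative v t) (at t within {0..})"
    and "(v has_vector_derivative u) (at t within {0..})"
    and "(xb has_vector_derivative - k2 *\<^sub>R (xb t - x t) + vb t) (at t within {0..})"
    and "(vb has_vector_derivative - k3 *\<^sub>R (xb t - x t) + u) (at t within {0..})"
    and "(z has_vector_derivative - k4 *\<^sub>R consensus E (z t - (\<chi> i. x t))) (at t within {0..})"
proof -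
  have u: "control f k1 (vb t) (z t) = u"
    by (simp add: control_def u_def own_gradients_def vec_eq_iff algebra_simps)
  note cl = assms(1)[unfolded closed_loop_def, rule_format, OF assms(2),
      unfolded u has_real_derivative_iff_has_vector_derivative]
  show "(x has_vector_derivative v t) (at t within {0..})"
    and "(v has_vector_derivative u) (at t within {0..})"
    and "(xb has_vector_derivative - k2 *\<^sub>R (xb t - x t) + vb t) (at t within {0..})"
    and "(vb has_vector_derivative - k3 *\<^sub>R (xb t - x t) + u) (at t within {0..})"
    using cl by (auto intro!: has_vector_derivative_vecI)
  show "(z has_vector_derivative - k4 *\<^sub>R consensus E (z t - (\<chi> i. x t))) (at t within {0..})"
    using cl by (auto intro!: has_vector_derivative_vecI simp: consensus_def)
qed

lemma const_vec_has_vector_derivative: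
  fixes x :: "real \<Rightarrow> 'a::euclidean_space"
  assumes "(x has_vector_derivative d) (at t within S)"
  shows "((\<lambda>s. (\<chi> i::'n::finite. x s)) has_vector_derivative (\<chi> i. d)) (at t within S)"
  using assms by (intro has_vector_derivative_vecI) simp

text \<open>
  The combination \<open>q = v + P x\<close> measures how far the velocity is from the gradient play \<open>x' = - P x\<close>.
  Writing \<open>vb = v + b\<close>, the control becomes \<open>- k1 q\<close> up to the estimation error and the observer error \<open>b\<close>,
  and differentiating \<open>P x\<close> along the trajectory contributes the Hessian term. The control cancels from the
  observer errors, which therefore evolve autonomously.
\<close>

lemma closed_loop_error_derivatives:
  fixes f :: "'n::finite \<Rightarrow> real^'n \<Rightarrow> real"
  assumes cl: "closed_loop f E k1 k2 k3 k4 x v xb vb z" and t: "t \<ge> 0"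
    and diff: "\<And>i. twice_continuously_differentiable (f i)"
  shows "((\<lambda>s. x s - xs) has_vector_derivative v t) (at t within {0..})"
    and "((\<lambda>s. v s + pseudo_gradient f (x s)) has_vector_derivative
      - k1 *\<^sub>R (own_gradients f (z t) - pseudo_gradient f (x t)) - k1 *\<^sub>R (v t + pseudo_gradient f (x t))
      - k1 *\<^sub>R (vb t - v t) + game_hessian f (x t) *v v t) (at t within {0..})"
    and "((\<lambda>s. z s - (\<chi> i. x s)) has_vector_derivative
      - k4 *\<^sub>R consensus E (z t - (\<chi> i. x t)) - (\<chi> i. v t)) (at t within {0..})"
    and "((\<lambda>s. xb s - x s) has_vector_derivative - k2 *\<^sub>R (xb t - x t) + (vb t - v t))
      (at t within {0..})"
    and "((\<lambda>s. vb s - v s) has_vector_derivative - k3 *\<^sub>R (xb t - x t)) (at t within {0..})"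
proof -
  note der = closed_loop_vector_derivatives[OF cl t]
  show "((\<lambda>s. x s - xs) has_vector_derivative v t) (at t within {0..})"
    using has_vector_derivative_diff[OF der(1) has_vector_derivative_const[of xs]] by simp
  show "((\<lambda>s. z s - (\<chi> i. x s)) has_vector_derivative
      - k4 *\<^sub>R consensus E (z t - (\<chi> i. x t)) - (\<chi> i. v t)) (at t within {0..})"
    by (intro has_vector_derivative_diff der const_vec_has_vector_derivative)
  show "((\<lambda>s. xb s - x s) has_vector_derivative - k2 *\<^sub>R (xb t - x t) + (vb t - v t))
      (at t within {0..})"
    using has_vector_derivative_diff[OF der(3) der(1)] by (simp only: add_diff_eq)
  show "((\<lambda>s. vb s - v s) has_vector_derivative - k3 *\<^sub>R (xb t - x t)) (at t within {0..})"
    using has_vector_derivative_diff[OF der(4) der(2)] by simp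
  have "((\<lambda>s. pseudo_gradient f (x s)) has_vector_derivative game_hessian f (x t) *v v t)
      (at t within {0..})"
    using has_derivative_compose[OF der(1)[unfolded has_vector_derivative_def]
        pseudo_gradient_has_derivative[OF diff]]
    by (simp add: has_vector_derivative_def matrix_vector_mult_scaleR)
  from has_vector_derivative_add[OF der(2) this]
  show "((\<lambda>s. v s + pseudo_gradient f (x s)) has_vector_derivative
      - k1 *\<^sub>R (own_gradients f (z t) - pseudo_gradient f (x t)) - k1 *\<^sub>R (v t + pseudo_gradient f (x t))
      - k1 *\<^sub>R (vb t - v t) + game_hessian f (x t) *v v t) (at t within {0..})"
    by (rule has_vector_derivative_eq_rhs) (simp add: algebra_simps)
qed

text \<open>
  Along the closed loop the left-hand side is half the derivative of \<open>|x - xs|\<^sup>2 + |q|\<^sup>2 + |w|\<^sup>2\<close>. Strong monotonicity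
  damps the first term, the gain \<open>k1\<close> the second and \<open>k4 lam\<close> the third; the rest is estimated by
  Cauchy-Schwarz, with \<open>v = q - P x\<close> and \<open>|P x| = |P x - P xs| \<le> sN L Y\<close>. The factor \<open>sN = \<surd>N\<close> in the last term
  arises because the velocity enters the error of each of the \<open>N\<close> estimates.
\<close>

lemma error_dissipation:
  fixes f :: "'n::finite \<Rightarrow> real^'n \<Rightarrow> real" and x xs v b :: "real^'n" and z :: "real^'n^'n"
  assumes lip: "\<And>i. L-lipschitz_on UNIV (partial_deriv i (f i))"
    and mono: "\<And>x y. (x - y) \<bullet> (pseudo_gradient f x - pseudo_gradient f y) \<ge> m * (norm (x - y))\<^sup>2"
    and hess: "norm (game_hessian f x *v v) \<le> h * norm v" and "h \<ge> 0"
    and cons: "lam * (norm (z - (\<chi> i. x)))\<^sup>2 \<le> (z - (\<chi> i. x)) \<bullet> consensus E (z - (\<chi> i. x))"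
    and zero: "pseudo_gradient f xs = 0" and k: "k1 > 0" "k4 > 0"
  defines "q \<equiv> v + pseudo_gradient f x" and "w \<equiv> z - (\<chi> i. x)" and "sN \<equiv> sqrt (real CARD('n))"
  defines "Y \<equiv> norm (x - xs)" and "Q \<equiv> norm q" and "Z \<equiv> norm w" and "e \<equiv> norm b"
  shows "(x - xs) \<bullet> v
      + q \<bullet> (- k1 *\<^sub>R (own_gradients f z - pseudo_gradient f x) - k1 *\<^sub>R q - k1 *\<^sub>R b + game_hessian f x *v v)
      + w \<bullet> (- k4 *\<^sub>R consensus E w - (\<chi> i. v))
    \<le> Y * Q - m * Y\<^sup>2 + k1 * L * (Q * Z) - k1 * Q\<^sup>2 + k1 * (Q * e) + h * (Q * (Q + sN * L * Y))
      - k4 * lam * Z\<^sup>2 + sN * (Z * (Q + sN * L * Y))"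
proof -
  let ?P = "pseudo_gradient f"
  have neg_inner: "- (a \<bullet> c) \<le> norm a * norm c" for a c :: "'b::real_inner"
    using Cauchy_Schwarz_ineq2[of a c] by linarith
  have v: "v = q - ?P x"
    by (simp add: q_def)
  have Px: "norm (?P x) \<le> sN * L * Y"
    using pseudo_gradient_lipschitz[OF lip, of x xs] zero by (simp add: sN_def Y_def)
  have normv: "norm v \<le> Q + sN * L * Y"
    using norm_triangle_ineq4[of q "?P x"] Px by (simp add: v Q_def)
  have "(x - xs) \<bullet> v = (x - xs) \<bullet> q - (x - xs) \<bullet> (?P x - ?P xs)"
    by (simp add: v zero inner_diff_right)
  also have "\<dots> \<le> Y * Q - m * Y\<^sup>2"
    unfolding Y_def Q_def by (intro diff_mono norm_cauchy_schwarz mono)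
  finally have 1: "(x - xs) \<bullet> v \<le> Y * Q - m * Y\<^sup>2" .
  have G: "norm (own_gradients f z - ?P x) \<le> L * Z"
    unfolding pseudo_gradient_eq_own_gradients Z_def w_def by (rule own_gradients_lipschitz[OF lip])
  have "- (q \<bullet> (own_gradients f z - ?P x)) \<le> Q * (L * Z)"
    unfolding Q_def by (rule order_trans[OF neg_inner mult_left_mono[OF G]]) simp
  then have 2: "k1 * (- (q \<bullet> (own_gradients f z - ?P x))) \<le> k1 * (Q * (L * Z))"
    using k by (intro mult_left_mono) auto
  have 3: "k1 * (- (q \<bullet> b)) \<le> k1 * (Q * e)"
    unfolding Q_def e_def by (rule mult_left_mono[OF neg_inner]) (use k in simp)
  have "q \<bullet> (game_hessian f x *v v) \<le> Q * norm (game_hessian f x *v v)"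
    unfolding Q_def by (rule norm_cauchy_schwarz)
  also have "\<dots> \<le> Q * (h * (Q + sN * L * Y))"
    using order_trans[OF hess mult_left_mono[OF normv \<open>h \<ge> 0\<close>]]
    by (intro mult_left_mono) (auto simp: Q_def)
  finally have 4: "q \<bullet> (game_hessian f x *v v) \<le> h * (Q * (Q + sN * L * Y))"
    by (simp add: mult_ac)
  have 5: "k4 * (lam * Z\<^sup>2) \<le> k4 * (w \<bullet> consensus E w)"
    using k cons by (auto simp: Z_def w_def)
  have "- (w \<bullet> (\<chi> i. v)) \<le> Z * norm (\<chi> i::'n. v)"
    unfolding Z_def by (rule neg_inner)
  also have "\<dots> = sN * (Z * norm v)"
    by (simp add: norm_const_vec sN_def mult_ac)
  also have "\<dots> \<le> sN * (Z * (Q + sN * L * Y))"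
    using normv by (intro mult_left_mono) (auto simp: sN_def Z_def)
  finally have 6: "- (w \<bullet> (\<chi> i. v)) \<le> sN * (Z * (Q + sN * L * Y))" .
  have "(x - xs) \<bullet> v
      + q \<bullet> (- k1 *\<^sub>R (own_gradients f z - ?P x) - k1 *\<^sub>R q - k1 *\<^sub>R b + game_hessian f x *v v)
      + w \<bullet> (- k4 *\<^sub>R consensus E w - (\<chi> i. v))
    = (x - xs) \<bullet> v + k1 * (- (q \<bullet> (own_gradients f z - ?P x))) - k1 * Q\<^sup>2 + k1 * (- (q \<bullet> b))
      + q \<bullet> (game_hessian f x *v v) - k4 * (w \<bullet> consensus E w) + - (w \<bullet> (\<chi> i. v))"
    unfolding inner_add_right inner_diff_right[of q _ "k1 *\<^sub>R q"] inner_diff_right[of q _ "k1 *\<^sub>R b"]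
      inner_diff_right[of w] inner_scaleR_right Q_def power2_norm_eq_inner by simp
  also have "\<dots> \<le> (Y * Q - m * Y\<^sup>2) + k1 * (Q * (L * Z)) - k1 * Q\<^sup>2 + k1 * (Q * e)
      + h * (Q * (Q + sN * L * Y)) - k4 * (lam * Z\<^sup>2) + sN * (Z * (Q + sN * L * Y))"
    using 1 2 3 4 5 6 by linarith
  also have "\<dots> = Y * Q - m * Y\<^sup>2 + k1 * L * (Q * Z) - k1 * Q\<^sup>2 + k1 * (Q * e)
      + h * (Q * (Q + sN * L * Y)) - k4 * lam * Z\<^sup>2 + sN * (Z * (Q + sN * L * Y))"
    by (simp add: mult_ac)
  finally show ?thesis .
qed

section \<open>Convergence to the Nash equilibrium\<close>

lemma tendsto_norm_zero_if_square_le: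
  assumes W: "(W \<longlongrightarrow> (0::real)) at_top" and le: "\<And>t. t \<ge> 0 \<Longrightarrow> (norm (g t))\<^sup>2 \<le> W (t::real)"
  shows "((\<lambda>t. norm (g t)) \<longlongrightarrow> 0) at_top"
proof (rule tendsto_sandwich[OF _ _ tendsto_const])
  show "((\<lambda>t. sqrt (W t)) \<longlongrightarrow> 0) at_top"
    using tendsto_real_sqrt[OF W] by simp
  show "\<forall>\<^sub>F t in at_top. norm (g t) \<le> sqrt (W t)"
    using le by (intro eventually_at_top_linorderI[of 0] real_le_rsqrt)
qed simp

text \<open>
  The errors \<open>x - xs\<close>, \<open>q\<close>, \<open>w\<close> dissipate their energy \<open>V\<close> except for a multiple of \<open>|b|\<^sup>2\<close>, which the decay
  of the observer energy \<open>U\<close> compensates. Thus \<open>V + \<kappa> U\<close> decays exponentially for \<open>\<kappa>\<close> large.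
\<close>

lemma closed_loop_converges:
  fixes f :: "'n::finite \<Rightarrow> real^'n \<Rightarrow> real"
  defines "sN \<equiv> sqrt (real CARD('n))"
  assumes diff: "\<And>i. twice_continuously_differentiable (f i)"
    and lip: "\<And>i. L-lipschitz_on UNIV (partial_deriv i (f i))"
    and mono: "\<And>x y. (x - y) \<bullet> (pseudo_gradient f x - pseudo_gradient f y) \<ge> m * (norm (x - y))\<^sup>2"
    and hess: "\<And>x w. norm (game_hessian f x *v w) \<le> h * norm w" and h: "h \<ge> 0"
    and cons: "\<And>w. lam * (norm w)\<^sup>2 \<le> w \<bullet> consensus E w"
    and k: "k1 > 0" "k2 > 0" "k3 > 0" "k4 > 0"
    and \<epsilon>: "\<epsilon>1 > 0" "\<epsilon>2 > 0" "\<epsilon>3 > 0"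
    and gain1: "(h * sN * L + 1) * \<epsilon>1 / 2 + sN\<^sup>2 * L * \<epsilon>2 / 2 < m"
    and gain2: "h + (h * sN * L + 1) / (2 * \<epsilon>1) + (sN + L) / 2 < k1 - k1 / (2 * \<epsilon>3)"
    and gain3: "sN / 2 + sN\<^sup>2 * L / (2 * \<epsilon>2) + k1\<^sup>2 * L / 2 < k4 * lam"
    and zero: "pseudo_gradient f xs = 0"
    and cl: "closed_loop f E k1 k2 k3 k4 x v xb vb z"
  shows "((\<lambda>t. norm (x t - xs)) \<longlongrightarrow> 0) at_top" and "((\<lambda>t. norm (v t)) \<longlongrightarrow> 0) at_top"
proof -
  have L: "L \<ge> 0"
    using lip by (rule lipschitz_on_nonneg)
  define q where "q t = v t + pseudo_gradient f (x t)" for t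
  define w where "w t = z t - (\<chi> i. x t)" for t
  define a where "a t = xb t - x t" for t
  define b where "b t = vb t - v t" for t
  define V where "V t = (norm (x t - xs))\<^sup>2 + (norm (q t))\<^sup>2 + (norm (w t))\<^sup>2" for t
  define U where "U t = observer_energy k2 k3 (a t) (b t)" for t
  define c1 where "c1 = m - ((h * sN * L + 1) * \<epsilon>1 / 2 + sN\<^sup>2 * L * \<epsilon>2 / 2)"
  define c2 where "c2 = k1 - k1 / (2 * \<epsilon>3) - (h + (h * sN * L + 1) / (2 * \<epsilon>1) + (sN + L) / 2)"
  define c3 where "c3 = k4 * lam - (sN / 2 + sN\<^sup>2 * L / (2 * \<epsilon>2) + k1\<^sup>2 * L / 2)"
  define \<alpha> where "\<alpha> = min c1 (min c2 c3)"
  have \<alpha>: "\<alpha> > 0" "\<alpha> \<le> c1" "\<alpha> \<le> c2" "\<alpha> \<le> c3"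
    using gain1 gain2 gain3 by (auto simp: \<alpha>_def c1_def c2_def c3_def)
  define \<gamma> where "\<gamma> = min (k2 * k3) (cross_weight k2 k3)"
  have \<gamma>: "\<gamma> > 0"
    using k cross_weight_pos[OF k(2,3)] by (simp add: \<gamma>_def)
  \<comment> \<open>The summand 1 leaves \<open>|a|\<^sup>2 + |b|\<^sup>2\<close> after compensation, to bound the decay of \<open>\<kappa> U\<close> from below.\<close>
  define \<kappa> where "\<kappa> = (k1 * \<epsilon>3 + 1) / \<gamma>"
  have \<kappa>: "\<kappa> > 0" "\<kappa> * \<gamma> = k1 * \<epsilon>3 + 1"
    using k \<epsilon> \<gamma> by (auto simp: \<kappa>_def intro!: divide_pos_pos add_pos_pos)
  define C where "C = 2 * (k3 + 1)"
  have C: "C > 0"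
    using k by (simp add: C_def)
  define c where "c = min (2 * \<alpha>) (1 / (\<kappa> * C))"
  have c: "c > 0" "c \<le> 2 * \<alpha>" "c \<le> 1 / (\<kappa> * C)"
    using \<alpha> \<kappa> C by (auto simp: c_def)
  define W where "W t = V t + \<kappa> * U t" for t
  have V0: "V t \<ge> 0" and U0: "U t \<ge> 0" for t
    using observer_energy_bounds(1)[OF k(2,3)] by (auto simp: V_def U_def)
  have "\<exists>D. (W has_real_derivative D) (at t within {0..}) \<and> D \<le> - c * W t" if t: "t \<ge> 0" for t
  proof -
    note der = closed_loop_error_derivatives[OF cl t diff,
        folded q_def w_def a_def b_def]
    define S where "S = (x t - xs) \<bullet> v t
      + q t \<bullet> (- k1 *\<^sub>R (own_gradients f (z t) - pseudo_gradient f (x t)) - k1 *\<^sub>R q t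
          - k1 *\<^sub>R b t + game_hessian f (x t) *v v t)
      + w t \<bullet> (- k4 *\<^sub>R consensus E (w t) - (\<chi> i. v t))"
    have V': "(V has_real_derivative 2 * S) (at t within {0..})"
      using DERIV_add[OF DERIV_add[OF has_real_derivative_norm_square[OF der(1)[of xs]]
            has_real_derivative_norm_square[OF der(2)]] has_real_derivative_norm_square[OF der(3)]]
      unfolding V_def[abs_def] S_def by (simp only: distrib_left)
    obtain DU where U': "(U has_real_derivative DU) (at t within {0..})"
      and DU: "DU \<le> - \<gamma> * ((norm (a t))\<^sup>2 + (norm (b t))\<^sup>2)"
      using observer_energy_decay[OF k(2,3) der(4,5)] unfolding U_def[abs_def] \<gamma>_def by blast
    have "S \<le> - c1 * (norm (x t - xs))\<^sup>2 - c2 * (norm (q t))\<^sup>2 - c3 * (norm (w t))\<^sup>2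
        + k1 * \<epsilon>3 / 2 * (norm (b t))\<^sup>2"
      unfolding c1_def c2_def c3_def S_def q_def w_def sN_def
      by (rule order_trans[OF error_dissipation[OF lip mono hess h cons zero k(1,4)]
            error_dissipation_scalar]) (use L h k \<epsilon> in auto)
    also have "\<dots> \<le> - \<alpha> * (norm (x t - xs))\<^sup>2 - \<alpha> * (norm (q t))\<^sup>2 - \<alpha> * (norm (w t))\<^sup>2
        + k1 * \<epsilon>3 / 2 * (norm (b t))\<^sup>2"
      using \<alpha> by (intro add_mono diff_mono mult_right_mono) auto
    also have "\<dots> = - \<alpha> * V t + k1 * \<epsilon>3 / 2 * (norm (b t))\<^sup>2"
      by (simp add: V_def algebra_simps)
    finally have "2 * S \<le> - (2 * \<alpha> * V t) + k1 * \<epsilon>3 * (norm (b t))\<^sup>2"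
      by simp
    moreover have "\<kappa> * DU \<le> \<kappa> * (- \<gamma> * ((norm (a t))\<^sup>2 + (norm (b t))\<^sup>2))"
      using DU \<kappa> by (intro mult_left_mono) auto
    moreover have "\<kappa> * (- \<gamma> * ((norm (a t))\<^sup>2 + (norm (b t))\<^sup>2))
        = - (k1 * \<epsilon>3 + 1) * ((norm (a t))\<^sup>2 + (norm (b t))\<^sup>2)"
      unfolding \<kappa>(2)[symmetric] by simp
    moreover have "k1 * \<epsilon>3 * (norm (a t))\<^sup>2 \<ge> 0"
      using k \<epsilon> by simp
    ultimately have "2 * S + \<kappa> * DU \<le> - (2 * \<alpha> * V t) - ((norm (a t))\<^sup>2 + (norm (b t))\<^sup>2)"
      by (simp add: algebra_simps)
    moreover have "1 / (\<kappa> * C) * (\<kappa> * U t) \<le> (norm (a t))\<^sup>2 + (norm (b t))\<^sup>2"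
    proof -
      have "U t \<le> C * ((norm (a t))\<^sup>2 + (norm (b t))\<^sup>2)"
        unfolding U_def C_def by (rule observer_energy_bounds(2)[OF k(2,3)])
      then have "U t / C \<le> (norm (a t))\<^sup>2 + (norm (b t))\<^sup>2"
        using C by (simp add: pos_divide_le_eq mult.commute)
      then show ?thesis
        using \<kappa>(1) by simp
    qed
    moreover have "c * V t \<le> 2 * \<alpha> * V t"
      by (rule mult_right_mono[OF c(2) V0])
    moreover have "c * (\<kappa> * U t) \<le> 1 / (\<kappa> * C) * (\<kappa> * U t)"
      by (rule mult_right_mono[OF c(3)]) (use U0 \<kappa>(1) in simp)
    ultimately have "2 * S + \<kappa> * DU \<le> - c * W t"
      unfolding W_def by (simp add: distrib_left)
    moreover have "(W has_real_derivative 2 * S + \<kappa> * DU) (at t within {0..})"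
      unfolding W_def[abs_def] by (intro DERIV_add DERIV_cmult V' U')
    ultimately show ?thesis
      by blast
  qed
  then obtain D where "\<And>t. t \<ge> 0 \<Longrightarrow> (W has_real_derivative D t) (at t within {0..})"
    and "\<And>t. t \<ge> 0 \<Longrightarrow> D t \<le> - c * W t"
    by metis
  then have W: "(W \<longlongrightarrow> 0) at_top"
    by (rule differential_inequality_tendsto_zero[OF _ _ _ c(1)])
      (use V0 U0 \<kappa> in \<open>auto simp: W_def intro!: add_nonneg_nonneg mult_nonneg_nonneg\<close>)
  have VW: "V t \<le> W t" for t
    using U0 \<kappa> by (simp add: W_def)
  show x: "((\<lambda>t. norm (x t - xs)) \<longlongrightarrow> 0) at_top"
    by (rule tendsto_norm_zero_if_square_le[OF W order_trans[OF _ VW]]) (simp add: V_def)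
  have q: "((\<lambda>t. norm (q t)) \<longlongrightarrow> 0) at_top"
    by (rule tendsto_norm_zero_if_square_le[OF W order_trans[OF _ VW]]) (simp add: V_def)
  have v: "norm (v t) \<le> norm (q t) + sN * L * norm (x t - xs)" for t
    using norm_triangle_ineq4[of "q t" "pseudo_gradient f (x t)"]
      pseudo_gradient_lipschitz[OF lip, of "x t" xs] zero
    by (simp add: q_def sN_def)
  have lim: "((\<lambda>t. norm (q t) + sN * L * norm (x t - xs)) \<longlongrightarrow> 0) at_top"
    using tendsto_add[OF q tendsto_mult_right_zero[OF x, of "sN * L"]] by simp
  show "((\<lambda>t. norm (v t)) \<longlongrightarrow> 0) at_top"
    by (rule tendsto_sandwich[OF _ _ tendsto_const lim]) (simp_all add: v)
qed

theorem theorem3: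
  fixes f :: "'n::finite \<Rightarrow> real^'n \<Rightarrow> real"
    and E :: "('n \<times> 'n) set"
    and l :: "'n \<Rightarrow> real"
    and m h k1 k2 k3 k4 \<epsilon>1 \<epsilon>2 \<epsilon>3 N L lam :: real
  assumes "CARD('n) \<ge> 2"
    and "undirected_connected E"
    and "\<And>i. twice_continuously_differentiable (f i)"
    and "m > 0"
    and "\<And>x y. (x - y) \<bullet> (pseudo_gradient f x - pseudo_gradient f y) \<ge> m * (norm (x - y))\<^sup>2"
    and "h > 0"
    and "bdd_above (range (\<lambda>x. onorm (\<lambda>w. game_hessian f x *v w)))"
    and "(SUP x. onorm (\<lambda>w. game_hessian f x *v w)) = h"
    and "\<And>i. (l i)-lipschitz_on UNIV (partial_deriv i (f i))"
    and "k1 > 0" "k2 > 0" "k3 > 0" "k4 > 0"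
    and "N = real CARD('n)"
    and "L = Max (range l)"
    and "lam = lambda_min (kronecker (laplacian E) (mat 1 :: real^'n^'n) + adjacency_diag E)"
    and "\<epsilon>1 > 0" "\<epsilon>2 > 0" "\<epsilon>3 > 1 / 2"
    and "(h * sqrt N * L + 1) * \<epsilon>1 / 2 + N * L * \<epsilon>2 / 2 < m"
    and "k1 > 2 * \<epsilon>3 / (2 * \<epsilon>3 - 1) *
           (h + (h * sqrt N * L + 1) / (2 * \<epsilon>1) + (sqrt N + L) / 2)"
    and "k4 > sqrt N / (2 * lam) + N * L / (2 * \<epsilon>2 * lam) + k1\<^sup>2 * L / (2 * lam)"
  shows "(\<exists>!xstar. nash_equilibrium f xstar) \<and>
    (\<forall>xstar x v xb vb z.
       nash_equilibrium f xstar \<longrightarrow> closed_loop f E k1 k2 k3 k4 x v xb vb z \<longrightarrow>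
         ((\<lambda>t. norm (x t - xstar)) \<longlongrightarrow> 0) at_top \<and>
         ((\<lambda>t. norm (v t)) \<longlongrightarrow> 0) at_top)"
proof -
  note card = assms(1) and conn = assms(2) and diff = assms(3) and m = assms(4) and mono = assms(5)
    and h = assms(6) and lip = assms(9) and k = assms(10-13) and N = assms(14) and L = assms(15)
    and lam = assms(16) and \<epsilon> = assms(17-19) and gain = assms(20-22)
  let ?P = "pseudo_gradient f"
  have lipL: "L-lipschitz_on UNIV (partial_deriv i (f i))" for i
    using lip[of i] by (rule lipschitz_on_mono) (auto simp: L)
  then have L0: "L \<ge> 0"
    by (rule lipschitz_on_nonneg)
  have mono0: "(x - y) \<bullet> (?P x - ?P y) \<ge> 0" for x y
    using mono[of x y] m by (smt (verit) mult_nonneg_nonneg zero_le_power2)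
  have "f i differentiable (at x)" for i x
    using diff[of i]
    by (simp add: twice_continuously_differentiable_def continuously_differentiable_def)
  then have nash: "nash_equilibrium f x \<longleftrightarrow> ?P x = 0" for x
    by (rule nash_equilibrium_iff_pseudo_gradient_zero[OF _ mono0])
  have ex1: "\<exists>!xs. nash_equilibrium f xs"
    unfolding nash
    by (rule strongly_monotone_lipschitz_unique_zero[OF m _ mono pseudo_gradient_lipschitz[OF lipL]])
      (use L0 in simp)
  have hess: "norm (game_hessian f x *v w) \<le> h * norm w" for x w
    using norm_matrix_vector_mult_le_SUP_onorm[OF assms(7), of x w] by (simp only: assms(8))
  have lam0: "lam > 0" and cons: "\<And>w. lam * (norm w)\<^sup>2 \<le> w \<bullet> consensus E w"
    unfolding lam using lambda_min_estimation_matrix[OF conn card] by blast+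
  have \<epsilon>3: "\<epsilon>3 > 0"
    using \<epsilon>(3) by simp
  have N2: "(sqrt N)\<^sup>2 = N"
    by (simp add: N)
  have gain2: "h + (h * sqrt N * L + 1) / (2 * \<epsilon>1) + (sqrt N + L) / 2 < k1 - k1 / (2 * \<epsilon>3)"
  proof -
    let ?R = "h + (h * sqrt N * L + 1) / (2 * \<epsilon>1) + (sqrt N + L) / 2"
    let ?r = "(2 * \<epsilon>3 - 1) / (2 * \<epsilon>3)"
    have "?R = ?r * (2 * \<epsilon>3 / (2 * \<epsilon>3 - 1) * ?R)"
      using \<epsilon> by simp
    also have "\<dots> < ?r * k1"
      using gain(2) \<epsilon> by (intro mult_strict_left_mono) auto
    also have "\<dots> = k1 - k1 / (2 * \<epsilon>3)"
      using \<epsilon> by (simp add: diff_divide_distrib left_diff_distrib)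
    finally show ?thesis .
  qed
  have gain3: "sqrt N / 2 + N * L / (2 * \<epsilon>2) + k1\<^sup>2 * L / 2 < k4 * lam"
  proof -
    have "(sqrt N / (2 * lam) + N * L / (2 * \<epsilon>2 * lam) + k1\<^sup>2 * L / (2 * lam)) * lam < k4 * lam"
      using gain(3) lam0 by (rule mult_strict_right_mono)
    then show ?thesis
      using lam0 by (simp add: distrib_right)
  qed
  have "((\<lambda>t. norm (x t - xs)) \<longlongrightarrow> 0) at_top \<and> ((\<lambda>t. norm (v t)) \<longlongrightarrow> 0) at_top"
    if "nash_equilibrium f xs" "closed_loop f E k1 k2 k3 k4 x v xb vb z" for xs x v xb vb z
    using closed_loop_converges[OF diff lipL mono hess less_imp_le[OF h] cons k \<epsilon>(1,2) \<epsilon>3 _ _ _ _ that(2),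
        of xs] gain(1) gain2 gain3 that(1)
    unfolding nash N[symmetric] N2 by simp
  then show ?thesis
    using ex1 by blast
qed

end
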